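(* Let $d\ge2$ be an integer, $1\le p<d$, $p^*=\frac{dp}{d-p}$, let $1\le q\le r\le p^*$, and let $\theta\in[0,1]$ satisfy $$\frac1r=\frac{\theta}{q}+\frac{1-\theta}{p^*}.$$ Then for any $\alpha,\beta\in\mathbb{R}$ there is a constant $C$ depending only on $d,p,q,r,\theta,\alpha,\beta$ such that for every $\tau>0$ and every smooth compactly supported function $u$ on $\Sigma_\tau\cong\mathbb{R}^d$, $$\tau^{(1-\theta)/d}\,\|u\|_{\mathcal{L}^r_{1+\theta\beta r}}\le C\left(\|u\|_{\mathcal{L}^q_{1+\beta q}}\right)^{\theta}\left(\|u\|_{\mathring{\mathcal{W}}^{1,p}_{1-p}}\right)^{1-\theta}$$ and $$\tau^{(1-\theta)/d}\,\|u\|_{\mathcal{L}^r_{1+(\theta\beta+(1-\theta)\alpha) r}}\le C\left(\|u\|_{\mathcal{L}^q_{1+\beta q}}\right)^{\theta}\left(\|u\|_{\mathcal{W}^{1,p}_{1-p+\alpha p}}\right)^{1-\theta}.$$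
   Context: For $\tau>0$ let $\Sigma_\tau=\{(t,x)\in\mathbb{R}^{1+d}: t^2-|x|^2=\tau^2,\ t>0\}$, parametrized by $x\in\mathbb{R}^d$ via $x\mapsto(\sqrt{\tau^2+|x|^2},x)$, and let $w_\tau(x)=\sqrt{\tau^2+|x|^2}$. The induced volume form is $\mathrm{dvol}=\frac{\tau}{w_\tau}\,dx^1\cdots dx^d$. The Lorentz boosts $L^i=x^i\partial_t+t\partial_{x^i}$ are tangent to $\Sigma_\tau$ and act there as $L^i=w_\tau\partial_{x^i}$. For $p\in[1,\infty)$, $\alpha\in\mathbb{R}$, $k\in\mathbb{N}$: $\|u\|_{\mathcal{L}^p_\alpha}=\left(\int_{\Sigma_\tau} w_\tau^\alpha|u|^p\,\mathrm{dvol}\right)^{1/p}$, $\|u\|_{\mathring{\mathcal{W}}^{k,p}_\alpha}=\sum_{i_1,\dots,i_k=1}^d\|L^{i_1}\cdots L^{i_k}u\|_{\mathcal{L}^p_\alpha}$ (with $\mathring{\mathcal W}^{0,p}_\alpha=\mathcal{L}^p_\alpha$), and $\|u\|_{\mathcal{W}^{k,p}_\alpha}=\sum_{j=0}^k\|u\|_{\mathring{\mathcal{W}}^{j,p}_\alpha}$. *)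

theory Defs
  imports "HOL-Analysis.Analysis"
begin

text \<open>
  Space-time is \<open>real \<times> (real^'n)\<close> with points \<open>(t, x)\<close>, and \<open>d\<close> is \<open>CARD('n)\<close>.
\<close>

definition hyp_weight :: "real \<Rightarrow> real^'n \<Rightarrow> real" where
  "hyp_weight \<tau> x = sqrt (\<tau>\<^sup>2 + (norm x)\<^sup>2)"

definition hyperboloid :: "real \<Rightarrow> (real \<times> (real^'n)) set" where
  "hyperboloid \<tau> = {(t, x). t\<^sup>2 - (norm x)\<^sup>2 = \<tau>\<^sup>2 \<and> t > 0}"

definition hyp_point :: "real \<Rightarrow> real^'n \<Rightarrow> real \<times> (real^'n)" where
  "hyp_point \<tau> x = (hyp_weight \<tau> x, x)"

text \<open>
  Functions on the hyperboloid are identified with functions on \<open>real^'n\<close> through this global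
  chart; every notion below is expressed in it.
\<close>

lemma hyp_weight_pos: "\<tau> > 0 \<Longrightarrow> hyp_weight \<tau> x > 0"
  by (simp add: hyp_weight_def add_pos_nonneg)

lemma bij_betw_hyp_point:
  assumes "\<tau> > 0"
  shows "bij_betw (hyp_point \<tau>) UNIV (hyperboloid \<tau>)"
proof (rule bij_betwI[where g = snd])
  show "hyp_point \<tau> \<in> UNIV \<rightarrow> hyperboloid \<tau>"
    using hyp_weight_pos[OF assms]
    by (auto simp: hyp_point_def hyperboloid_def) (simp add: hyp_weight_def)
  show "hyp_point \<tau> (snd y) = y" if "y \<in> hyperboloid \<tau>" for y
  proof -
    obtain t x where y: "y = (t, x)" by (cases y)
    with that have "\<tau>\<^sup>2 + (norm x)\<^sup>2 = t\<^sup>2" "t > 0" by (auto simp: hyperboloid_def)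
    then show ?thesis by (simp add: y hyp_point_def hyp_weight_def)
  qed
qed (auto simp: hyp_point_def)

text \<open>
  The induced volume form \<open>(\<tau> / w) dx\<^sup>1 \<dots> dx\<^sup>d\<close>.
\<close>

definition hyp_vol :: "real \<Rightarrow> (real^'n) measure" where
  "hyp_vol \<tau> = density lborel (\<lambda>x. ennreal (\<tau> / hyp_weight \<tau> x))"

definition partial :: "'n \<Rightarrow> (real^'n \<Rightarrow> real) \<Rightarrow> real^'n \<Rightarrow> real" where
  "partial i u x = deriv (\<lambda>s. u (x + s *\<^sub>R axis i 1)) 0"

definition boost :: "real \<Rightarrow> 'n \<Rightarrow> (real^'n \<Rightarrow> real) \<Rightarrow> real^'n \<Rightarrow> real" where
  "boost \<tau> i u x = hyp_weight \<tau> x * partial i u x"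

text \<open>
  In the chart, \<open>boost \<tau> i\<close> is the Lorentz boost \<open>x\<^sup>i \<partial>\<^sub>t + t \<partial>\<^sub>i\<close> of space-time,
  which is tangent to the hyperboloid:
\<close>

lemma boost_hyp_point:
  fixes F :: "real \<times> (real^'n) \<Rightarrow> real"
  assumes "\<tau> > 0" and F: "(F has_derivative F') (at (hyp_point \<tau> x))"
  shows "boost \<tau> i (F \<circ> hyp_point \<tau>) x =
    x $ i * F' (1, 0) + fst (hyp_point \<tau> x) * F' (0, axis i 1)"
proof -
  let ?e = "axis i 1 :: real^'n" and ?w = "hyp_weight \<tau> x"
  interpret F': bounded_linear F' using F by (rule has_derivative_bounded_linear)
  have w: "?w > 0" by (rule hyp_weight_pos[OF assms(1)])
  have e: "(norm (x + s *\<^sub>R ?e))\<^sup>2 = (norm x)\<^sup>2 + 2 * s * x $ i + s\<^sup>2" for s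
    by (simp add: power2_norm_eq_inner inner_add_left inner_add_right inner_axis inner_commute
        inner_axis_axis) (simp add: power2_eq_square inner_commute inner_axis)
  have "((\<lambda>s. sqrt (\<tau>\<^sup>2 + ((norm x)\<^sup>2 + 2 * s * x $ i + s\<^sup>2))) has_real_derivative x $ i / ?w) (at 0)"
    using w by (auto intro!: derivative_eq_intros simp: hyp_weight_def divide_simps)
  then have "((\<lambda>s. hyp_weight \<tau> (x + s *\<^sub>R ?e)) has_derivative (\<lambda>h. x $ i / ?w * h)) (at 0)"
    unfolding hyp_weight_def[of \<tau> "x + _ *\<^sub>R _"] e has_field_derivative_def .
  then have "((\<lambda>s. hyp_point \<tau> (x + s *\<^sub>R ?e)) has_derivative (\<lambda>h. (x $ i / ?w * h, h *\<^sub>R ?e))) (at 0)"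
    unfolding hyp_point_def by (auto intro!: derivative_eq_intros)
  from has_derivative_compose[OF this, of F F'] F
  have "((\<lambda>s. F (hyp_point \<tau> (x + s *\<^sub>R ?e))) has_derivative (\<lambda>h. F' (x $ i / ?w * h, h *\<^sub>R ?e))) (at 0)"
    by simp
  moreover have "F' (x $ i / ?w * h, h *\<^sub>R ?e) = (x $ i / ?w * F' (1, 0) + F' (0, ?e)) * h" for h
  proof -
    have "(x $ i / ?w * h, h *\<^sub>R ?e) = (x $ i / ?w * h) *\<^sub>R (1, 0) + h *\<^sub>R (0, ?e)" by simp
    then show ?thesis by (simp only: F'.add F'.scaleR) (simp add: algebra_simps)
  qed
  ultimately have "((\<lambda>s. F (hyp_point \<tau> (x + s *\<^sub>R ?e))) has_real_derivative
      (x $ i / ?w * F' (1, 0) + F' (0, ?e))) (at 0)"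
    by (simp add: has_field_derivative_def)
  then have "partial i (F \<circ> hyp_point \<tau>) x = x $ i / ?w * F' (1, 0) + F' (0, ?e)"
    by (simp add: partial_def DERIV_imp_deriv)
  then show ?thesis using w by (simp add: boost_def hyp_point_def field_simps)
qed

text \<open>
  \<open>C\<^sup>k\<close> on \<open>real^'n\<close>, by recursion over the partial derivatives.
\<close>

fun C_k :: "nat \<Rightarrow> (real^'n \<Rightarrow> real) \<Rightarrow> bool" where
  "C_k 0 u \<longleftrightarrow> continuous_on UNIV u"
| "C_k (Suc k) u \<longleftrightarrow> u differentiable_on UNIV \<and> (\<forall>i. C_k k (partial i u))"

definition smooth :: "(real^'n \<Rightarrow> real) \<Rightarrow> bool" where
  "smooth u \<longleftrightarrow> (\<forall>k. C_k k u)"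

definition compactly_supported :: "(real^'n \<Rightarrow> real) \<Rightarrow> bool" where
  "compactly_supported u \<longleftrightarrow> compact (closure {x. u x \<noteq> 0})"

text \<open>
  The integral is the Bochner integral, whose value is \<open>0\<close> on non-integrable functions. So the
  norms below carry their usual meaning only when the integrands are integrable, as they are for
  smooth compactly supported functions with \<open>\<tau> > 0\<close> and \<open>p \<ge> 1\<close>.
\<close>

definition L_norm :: "real \<Rightarrow> real \<Rightarrow> real \<Rightarrow> (real^'n \<Rightarrow> real) \<Rightarrow> real" where
  "L_norm \<tau> p \<alpha> u = (LINT x|hyp_vol \<tau>. hyp_weight \<tau> x powr \<alpha> * \<bar>u x\<bar> powr p) powr (1 / p)"

text \<open>
  The multi-index \<open>(i\<^sub>1, \<dots>, i\<^sub>k)\<close> is a list of length \<open>k\<close>, and \<open>foldr (boost \<tau>) [i\<^sub>1, \<dots>, i\<^sub>k] u\<close> is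
  \<open>L\<^bsup>i\<^sub>1\<^esup> \<dots> L\<^bsup>i\<^sub>k\<^esup> u\<close>.
\<close>

definition W_hom_norm :: "real \<Rightarrow> nat \<Rightarrow> real \<Rightarrow> real \<Rightarrow> (real^'n \<Rightarrow> real) \<Rightarrow> real" where
  "W_hom_norm \<tau> k p \<alpha> u =
    (\<Sum>is | length is = k. L_norm \<tau> p \<alpha> (foldr (boost \<tau>) is u))"

definition W_norm :: "real \<Rightarrow> nat \<Rightarrow> real \<Rightarrow> real \<Rightarrow> (real^'n \<Rightarrow> real) \<Rightarrow> real" where
  "W_norm \<tau> k p \<alpha> u = (\<Sum>j\<le>k. W_hom_norm \<tau> j p \<alpha> u)"

lemma W_hom_norm_0: "W_hom_norm \<tau> 0 p \<alpha> u = L_norm \<tau> p \<alpha> u"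
  by (simp add: W_hom_norm_def)

lemma W_hom_norm_1:
  fixes u :: "real^'n \<Rightarrow> real"
  shows "W_hom_norm \<tau> 1 p \<alpha> u = (\<Sum>i\<in>UNIV. L_norm \<tau> p \<alpha> (boost \<tau> i u))"
proof -
  have "{is :: 'n list. length is = 1} = (\<lambda>i. [i]) ` UNIV"
    by (auto simp: length_Suc_conv)
  then show ?thesis
    by (simp add: W_hom_norm_def sum.reindex inj_on_def)
qed

definition sobolev_conj :: "nat \<Rightarrow> real \<Rightarrow> real" where
  "sobolev_conj d p = real d * p / (real d - p)"

end

theory Submission
  imports Defs
begin

text \<open>
  In the chart, \<open>\<parallel>u\<parallel>\<close> in \<open>\<L>\<^sup>s\<close> with weight exponent \<open>1 + c s\<close> is \<open>\<tau>\<^bsup>1/s\<^esup>\<close> times the Lebesgue norm of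
  \<open>w\<^sup>c u\<close> in \<open>L\<^sup>s\<close>: the power of \<open>w\<close> in the volume form cancels the \<open>1\<close>. The same computation turns the
  \<open>\<L>\<^sup>p\<close> norm of \<open>L\<^sup>i u = w \<partial>\<^sub>i u\<close> with weight exponent \<open>1 - p + \<alpha> p\<close> into \<open>\<tau>\<^bsup>1/p\<^esup>\<close> times the \<open>L\<^sup>p\<close> norm
  of \<open>w\<^sup>\<alpha> \<partial>\<^sub>i u\<close>. Since \<open>1/r = \<theta>/q + (1-\<theta>) (1/p - 1/d)\<close>, the powers of \<open>\<tau>\<close> on both sides of the claim
  agree, and an inequality on Euclidean space remains.

  That inequality is interpolation followed by a Sobolev embedding. As
  \<open>w\<^bsup>\<theta>\<beta>+(1-\<theta>)\<alpha>\<^esup> \<bar>u\<bar> = \<bar>w\<^sup>\<beta> u\<bar>\<^sup>\<theta> \<bar>w\<^sup>\<alpha> u\<bar>\<^bsup>1-\<theta>\<^esup>\<close>, Hoelder's inequality bounds the left-hand side by the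
  \<open>L\<^sup>q\<close> norm of \<open>w\<^sup>\<beta> u\<close> and the \<open>L\<^bsup>p*\<^esup>\<close> norm of \<open>w\<^sup>\<alpha> u\<close> (\<open>hyperboloid_interpolation\<close>). The latter is
  bounded by the \<open>L\<^sup>p\<close> norms of the partial derivatives of \<open>w\<^sup>\<alpha> u\<close>. Because \<open>\<bar>\<partial>\<^sub>i w\<bar> \<le> 1\<close>, these
  are at most \<open>w\<^sup>\<alpha> \<bar>\<partial>\<^sub>i u\<bar> + \<bar>\<alpha>\<bar> w\<^bsup>\<alpha>-1\<^esup> \<bar>u\<bar>\<close> (\<open>weighted_Sobolev\<close>). The second term is what the
  inhomogeneous norm controls; it vanishes for \<open>\<alpha> = 0\<close>, which gives the estimate by the homogeneous
  norm.

  The Sobolev embedding itself (\<open>Gagliardo_Nirenberg_Sobolev\<close>) follows Gagliardo. By the fundamental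
  theorem of calculus \<open>\<bar>v\<bar>\<close> is at most the integral of \<open>\<bar>\<partial>\<^sub>i v\<bar>\<close> along the \<open>i\<close>-th coordinate line, so
  \<open>\<bar>v\<bar>\<^bsup>d/(d-1)\<^esup>\<close> is at most a product of \<open>d\<close> functions, the \<open>i\<close>-th of which is independent of \<open>x\<^sub>i\<close>.
  Integrating one variable after the other and applying Hoelder's inequality each time
  (\<open>nn_integral_Gagliardo\<close>) yields the case \<open>p = 1\<close>; the general case follows by taking for \<open>v\<close> a
  suitable power of \<open>u\<close>.
\<close>

section \<open>Hoelder's inequality for extended nonnegative functions\<close>

text \<open>
  The extension of \<open>x\<^sup>a\<close> to \<open>x = \<infinity>\<close> by its limit, for exponents \<open>a > 0\<close>. Iterated integrals can be
  infinite at single points, so that the argument for Gagliardo's lemma takes place in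
  \<^typ>\<open>ennreal\<close>.
\<close>

definition ennpowr :: "ennreal \<Rightarrow> real \<Rightarrow> ennreal" where
  "ennpowr x a = (if x = top then top else ennreal (enn2real x powr a))"

lemma ennpowr_ennreal: "0 \<le> x \<Longrightarrow> ennpowr (ennreal x) a = ennreal (x powr a)"
  by (simp add: ennpowr_def)

lemma ennpowr_top [simp]: "ennpowr top a = top"
  by (simp add: ennpowr_def)

lemma ennpowr_eq_0_iff [simp]: "ennpowr x a = 0 \<longleftrightarrow> x = 0"
  by (cases x) (auto simp: ennpowr_ennreal ennreal_eq_0_iff)

lemma ennpowr_mult: "ennpowr (x * y) a = ennpowr x a * ennpowr y a"
proof (cases "x = top \<or> y = top")
  case True
  then show ?thesis
    by (cases "x = 0"; cases "y = 0") (auto simp: ennreal_mult_top ennreal_top_mult)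
next
  case False
  then obtain r s where "x = ennreal r" "y = ennreal s" "0 \<le> r" "0 \<le> s"
    by (metis ennreal_cases)
  then show ?thesis
    by (simp add: ennpowr_ennreal powr_mult flip: ennreal_mult)
qed

lemma ennpowr_mono:
  assumes "x \<le> y" "0 \<le> a"
  shows "ennpowr x a \<le> ennpowr y a"
proof (cases "y = top")
  case False
  with assms have "x \<noteq> top" by (metis top.extremum_unique)
  with assms False show ?thesis
    by (auto simp: ennpowr_def intro!: ennreal_leI powr_mono2 enn2real_mono simp: less_top)
qed simp

lemma borel_measurable_ennpowr [measurable (raw)]:
  assumes [measurable]: "f \<in> borel_measurable M"
  shows "(\<lambda>x. ennpowr (f x) a) \<in> borel_measurable M"
  unfolding ennpowr_def by measurable

lemma weighted_geometric_le_arithmetic_mean: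
  fixes a x :: "'i \<Rightarrow> real"
  assumes "finite I" and a: "\<And>i. i \<in> I \<Longrightarrow> a i > 0" "(\<Sum>i\<in>I. a i) = 1"
    and x: "\<And>i. i \<in> I \<Longrightarrow> x i \<ge> 0"
  shows "(\<Prod>i\<in>I. x i powr a i) \<le> (\<Sum>i\<in>I. a i * x i)"
proof (cases "\<exists>i\<in>I. x i = 0")
  case True
  then have "(\<Prod>i\<in>I. x i powr a i) = 0" using assms by auto
  also have "\<dots> \<le> (\<Sum>i\<in>I. a i * x i)" 
    by (intro sum_nonneg mult_nonneg_nonneg) (auto simp: x a less_imp_le)
  finally show ?thesis .
next
  case False
  with x have pos: "x i > 0" if "i \<in> I" for i using that by (metis less_eq_real_def)
  have "I \<noteq> {}" using a by auto
  have "(\<Prod>i\<in>I. x i powr a i) = exp (\<Sum>i\<in>I. a i *\<^sub>R ln (x i))"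
    using pos assms(1) unfolding exp_sum[OF assms(1)] by (intro prod.cong refl) (simp add: powr_def order_less_imp_not_eq2)
  also have "\<dots> \<le> (\<Sum>i\<in>I. a i * exp (ln (x i)))"
    by (rule convex_on_sum[OF assms(1) \<open>I \<noteq> {}\<close> exp_convex]) (use a in \<open>simp_all add: order_less_imp_le\<close>)
  also have "\<dots> = (\<Sum>i\<in>I. a i * x i)" using pos by simp
  finally show ?thesis .
qed

lemma ennpowr_geometric_le_arithmetic_mean:
  fixes a :: "'i \<Rightarrow> real" and x :: "'i \<Rightarrow> ennreal"
  assumes "finite I" and a: "\<And>i. i \<in> I \<Longrightarrow> a i > 0" "(\<Sum>i\<in>I. a i) = 1"
  shows "(\<Prod>i\<in>I. ennpowr (x i) (a i)) \<le> (\<Sum>i\<in>I. ennreal (a i) * x i)"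
proof (cases "\<exists>i\<in>I. x i = top")
  case True
  then obtain j where j: "j \<in> I" "x j = top" by auto
  then have "ennreal (a j) * x j = top"
    using a(1)[of j] by (simp add: ennreal_mult_top ennreal_eq_0_iff not_le)
  then have "(\<Sum>i\<in>I. ennreal (a i) * x i) = top" using j assms(1) by (auto intro!: bexI[of _ j])
  then show ?thesis by simp
next
  case False
  have a0: "a i \<ge> 0" if "i \<in> I" for i using a(1)[OF that] by simp
  define y where "y i = enn2real (x i)" for i
  have x: "x i = ennreal (y i)" if "i \<in> I" for i using False that by (auto simp: y_def less_top)
  have y: "y i \<ge> 0" for i by (simp add: y_def)
  have "(\<Prod>i\<in>I. ennpowr (x i) (a i)) = ennreal (\<Prod>i\<in>I. y i powr a i)"
    using x y by (simp add: ennpowr_ennreal prod_ennreal)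
  also have "\<dots> \<le> ennreal (\<Sum>i\<in>I. a i * y i)"
    by (intro ennreal_leI weighted_geometric_le_arithmetic_mean assms y)
  also have "\<dots> = (\<Sum>i\<in>I. ennreal (a i * y i))"
    by (rule sum_ennreal[symmetric]) (simp add: a0 y)
  also have "\<dots> = (\<Sum>i\<in>I. ennreal (a i) * x i)"
    using a0 x y by (intro sum.cong refl) (metis ennreal_mult)
  finally show ?thesis .
qed

text \<open>
  After division of each factor by its integral \<open>c\<^sub>i\<close> the right-hand side is \<open>1\<close>, and the weighted
  inequality between the geometric and the arithmetic mean bounds the integrand on the left by a
  convex combination of functions of integral \<open>1\<close>.
\<close>

theorem nn_integral_Hoelder:
  fixes a :: "'i \<Rightarrow> real" and f :: "'i \<Rightarrow> 'b \<Rightarrow> ennreal"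
  assumes fin: "finite I" and a: "\<And>i. i \<in> I \<Longrightarrow> a i > 0" "(\<Sum>i\<in>I. a i) = 1"
    and f [measurable]: "\<And>i. i \<in> I \<Longrightarrow> f i \<in> borel_measurable M"
  shows "(\<integral>\<^sup>+x. (\<Prod>i\<in>I. ennpowr (f i x) (a i)) \<partial>M) \<le> (\<Prod>i\<in>I. ennpowr (\<integral>\<^sup>+x. f i x \<partial>M) (a i))"
proof -
  define c where "c i = (\<integral>\<^sup>+x. f i x \<partial>M)" for i
  consider (zero) j where "j \<in> I" "c j = 0" | (top) j where "j \<in> I" "c j = top" "\<forall>i\<in>I. c i \<noteq> 0"
    | (fin) "\<And>i. i \<in> I \<Longrightarrow> c i \<noteq> 0 \<and> c i \<noteq> top" by blast
  then show ?thesis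
  proof cases
    case zero
    then have "AE x in M. f j x = 0"
      by (simp add: c_def nn_integral_0_iff_AE)
    then have "AE x in M. (\<Prod>i\<in>I. ennpowr (f i x) (a i)) = 0"
      by eventually_elim (use zero fin in auto)
    then have "(\<integral>\<^sup>+x. (\<Prod>i\<in>I. ennpowr (f i x) (a i)) \<partial>M) = (\<integral>\<^sup>+x. 0 \<partial>M)"
      by (rule nn_integral_cong_AE)
    then show ?thesis by simp
  next
    case top
    have "(\<Prod>i\<in>I. ennpowr (c i) (a i)) = top"
      unfolding ennreal_prod_eq_top using top fin by (metis ennpowr_eq_0_iff ennpowr_top)
    then show ?thesis by (simp add: c_def)
  next
    case fin
    \<comment> \<open>Only the case \<open>0 < c i < \<infinity>\<close> allows the normalization.\<close>
    have eq: "f i x = c i * (f i x / c i)" if "i \<in> I" for i x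
      using fin[OF that] by (subst ennreal_times_divide, subst mult.commute) (simp add: mult_divide_eq_ennreal)
    have "\<And>i. i \<in> I \<Longrightarrow> a i \<ge> 0" using a(1) less_imp_le by blast
    then have sum_a: "(\<Sum>i\<in>I. ennreal (a i)) = 1" by (subst sum_ennreal) (simp_all add: a(2))
    have "(\<integral>\<^sup>+x. (\<Prod>i\<in>I. ennpowr (f i x) (a i)) \<partial>M)
        = (\<integral>\<^sup>+x. (\<Prod>i\<in>I. ennpowr (c i) (a i)) * (\<Prod>i\<in>I. ennpowr (f i x / c i) (a i)) \<partial>M)"
      unfolding prod.distrib[symmetric] ennpowr_mult[symmetric]
      by (intro nn_integral_cong prod.cong refl arg_cong2[where f = ennpowr] eq)
    also have "\<dots> \<le> (\<integral>\<^sup>+x. (\<Prod>i\<in>I. ennpowr (c i) (a i)) * (\<Sum>i\<in>I. ennreal (a i) * (f i x / c i)) \<partial>M)"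
      by (intro nn_integral_mono mult_left_mono ennpowr_geometric_le_arithmetic_mean assms) auto
    also have "\<dots> = (\<Prod>i\<in>I. ennpowr (c i) (a i)) * (\<Sum>i\<in>I. ennreal (a i) * (c i / c i))"
      by (simp add: nn_integral_cmult nn_integral_sum nn_integral_divide c_def cong: sum.cong)
    also have "(\<Sum>i\<in>I. ennreal (a i) * (c i / c i)) = (\<Sum>i\<in>I. ennreal (a i))"
      by (rule sum.cong) (use fin in \<open>auto simp: less_top[symmetric] ennreal_divide_self\<close>)
    also have "\<dots> = 1" by (fact sum_a)
    finally show ?thesis by (simp add: c_def)
  qed
qed

lemma integral_Hoelder:
  fixes f g :: "'b \<Rightarrow> real"
  assumes fg: "integrable M f" "integrable M g" "\<And>x. f x \<ge> 0" "\<And>x. g x \<ge> 0"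
    and ab: "a > 0" "b > 0" "a + b = 1"
  shows "(\<integral>x. f x powr a * g x powr b \<partial>M) \<le> (\<integral>x. f x \<partial>M) powr a * (\<integral>x. g x \<partial>M) powr b"
proof -
  have [measurable]: "f \<in> borel_measurable M" "g \<in> borel_measurable M" using fg by auto
  let ?F = "\<lambda>i::bool. if i then f else g" and ?a = "\<lambda>i::bool. if i then a else b"
  have "(\<integral>\<^sup>+x. ennreal (f x powr a * g x powr b) \<partial>M) = (\<integral>\<^sup>+x. (\<Prod>i\<in>UNIV. ennpowr (ennreal (?F i x)) (?a i)) \<partial>M)"
    by (simp add: UNIV_bool ennpowr_ennreal fg ennreal_mult mult.commute)
  also have "\<dots> \<le> (\<Prod>i\<in>UNIV. ennpowr (\<integral>\<^sup>+x. ennreal (?F i x) \<partial>M) (?a i))"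
    using ab by (intro nn_integral_Hoelder) (auto simp: UNIV_bool)
  also have "\<dots> = ennreal ((\<integral>x. f x \<partial>M) powr a * (\<integral>x. g x \<partial>M) powr b)"
    using fg by (simp add: UNIV_bool nn_integral_eq_integral ennpowr_ennreal integral_nonneg_AE
      ennreal_mult mult.commute)
  finally have "(\<integral>\<^sup>+x. ennreal (f x powr a * g x powr b) \<partial>M) \<le> \<dots>" .
  then show ?thesis
    by (subst integral_eq_nn_integral) (auto simp: enn2real_leI)
qed

section \<open>Gagliardo's lemma on product measures\<close>

text \<open>
  The integral of \<open>f\<close> over the variables in \<open>S\<close>, as a function on the whole product: \<open>f\<close> is a function
  of the variables in \<open>D\<close>, and the result ignores the entries of \<open>x\<close> in \<open>S\<close>. Keeping one domain for all
  \<open>S\<close> makes it possible to compare partial integrals over different sets of variables.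
\<close>

definition (in product_sigma_finite) partial_integral ::
    "'i set \<Rightarrow> 'i set \<Rightarrow> (('i \<Rightarrow> 'a) \<Rightarrow> ennreal) \<Rightarrow> ('i \<Rightarrow> 'a) \<Rightarrow> ennreal" where
  "partial_integral D S f x = (\<integral>\<^sup>+y. f (merge S (D - S) (y, x)) \<partial>Pi\<^sub>M S M)"

context product_sigma_finite begin

lemma measurable_partial_integral:
  assumes [measurable]: "f \<in> borel_measurable (Pi\<^sub>M D M)" and "S \<subseteq> D" "finite D"
  shows "partial_integral D S f \<in> borel_measurable (Pi\<^sub>M D M)"
proof -
  interpret S: sigma_finite_measure "Pi\<^sub>M S M"
    using assms finite_subset by (intro sigma_finite) auto
  \<comment> \<open>The second argument of \<^const>\<open>merge\<close> must lie in the product over \<open>D - S\<close>.\<close>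
  have eq: "merge S (D - S) (y, x) = merge S (D - S) (y, restrict x (D - S))" for x y
    by (auto simp: merge_def)
  have D: "S \<union> (D - S) = D" using assms by auto
  have [measurable]: "(\<lambda>(x, y). (y, restrict x (D - S))) \<in> (Pi\<^sub>M D M \<Otimes>\<^sub>M Pi\<^sub>M S M) \<rightarrow>\<^sub>M (Pi\<^sub>M S M \<Otimes>\<^sub>M Pi\<^sub>M (D - S) M)"
    using measurable_restrict_subset[of "D - S" D M] by measurable
  from measurable_compose[OF this measurable_merge, unfolded D]
  have "(\<lambda>p. merge S (D - S) (snd p, fst p)) \<in> (Pi\<^sub>M D M \<Otimes>\<^sub>M Pi\<^sub>M S M) \<rightarrow>\<^sub>M Pi\<^sub>M D M"
    by (simp only: case_prod_beta fst_conv snd_conv eq[symmetric])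
  then have [measurable]: "(\<lambda>(x, y). merge S (D - S) (y, x)) \<in> (Pi\<^sub>M D M \<Otimes>\<^sub>M Pi\<^sub>M S M) \<rightarrow>\<^sub>M Pi\<^sub>M D M"
    by (simp add: split_beta')
  show ?thesis unfolding partial_integral_def[abs_def] by measurable
qed

lemma partial_integral_empty:
  assumes "x \<in> space (Pi\<^sub>M D M)"
  shows "partial_integral D {} f x = f x"
proof -
  have "merge {} D (\<lambda>k. undefined, x) = x"
    using assms by (auto simp: merge_def space_PiM PiE_def extensional_def fun_eq_iff)
  then show ?thesis by (simp add: partial_integral_def nn_integral_empty)
qed

lemma partial_integral_all: "partial_integral D D f x = (\<integral>\<^sup>+y. f y \<partial>Pi\<^sub>M D M)"
  unfolding partial_integral_def
proof (rule nn_integral_cong)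
  fix y assume "y \<in> space (Pi\<^sub>M D M)"
  then have "merge D (D - D) (y, x) = y"
    by (auto simp: merge_def space_PiM PiE_def extensional_def fun_eq_iff)
  then show "f (merge D (D - D) (y, x)) = f y" by simp
qed

lemma partial_integral_upd:
  assumes "j \<in> S"
  shows "partial_integral D S f (x(j := t)) = partial_integral D S f x"
proof -
  have "merge S (D - S) (y, x(j := t)) = merge S (D - S) (y, x)" for y
    using assms by (auto simp: merge_def)
  then show ?thesis by (simp add: partial_integral_def)
qed

lemma partial_integral_insert:
  assumes "finite D" "S \<subseteq> D" "j \<in> D" "j \<notin> S"
    and x: "x \<in> space (Pi\<^sub>M D M)" and [measurable]: "f \<in> borel_measurable (Pi\<^sub>M D M)"
  shows "partial_integral D (insert j S) f x = (\<integral>\<^sup>+t. partial_integral D S f (x(j := t)) \<partial>M j)"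
proof -
  have eq: "merge (insert j S) (D - insert j S) (y(j := t), x) = merge S (D - S) (y, x(j := t))" for y t
    using assms by (auto simp: merge_def)
  have D: "insert j S \<union> (D - insert j S) = D" using assms by auto
  have fin: "finite S" using assms finite_subset by auto
  have "restrict x (D - insert j S) \<in> space (Pi\<^sub>M (D - insert j S) M)"
    using x by (auto simp: space_PiM)
  then have "(\<lambda>y. (y, restrict x (D - insert j S))) \<in>
      Pi\<^sub>M (insert j S) M \<rightarrow>\<^sub>M Pi\<^sub>M (insert j S) M \<Otimes>\<^sub>M Pi\<^sub>M (D - insert j S) M" by simp
  from measurable_compose[OF this measurable_merge, unfolded D]
  have "(\<lambda>y. merge (insert j S) (D - insert j S) (y, restrict x (D - insert j S))) \<in> Pi\<^sub>M (insert j S) M \<rightarrow>\<^sub>M Pi\<^sub>M D M" .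
  moreover have "merge (insert j S) (D - insert j S) (y, restrict x (D - insert j S)) =
     merge (insert j S) (D - insert j S) (y, x)" for y by (auto simp: merge_def)
  ultimately have [measurable]: "(\<lambda>y. merge (insert j S) (D - insert j S) (y, x)) \<in> Pi\<^sub>M (insert j S) M \<rightarrow>\<^sub>M Pi\<^sub>M D M"
    by simp
  show ?thesis unfolding partial_integral_def
    by (subst product_nn_integral_insert_rev) (use assms fin in \<open>simp_all add: eq\<close>)
qed

lemma partial_integral_singleton:
  assumes "finite D" "j \<in> D" "x \<in> space (Pi\<^sub>M D M)" "f \<in> borel_measurable (Pi\<^sub>M D M)"
  shows "partial_integral D {j} f x = (\<integral>\<^sup>+t. f (x(j := t)) \<partial>M j)"
proof -
  have "x(j := t) \<in> space (Pi\<^sub>M D M)" if "t \<in> space (M j)" for t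
    using assms that by (auto simp: space_PiM PiE_def extensional_def)
  then show ?thesis
    using partial_integral_insert[of D "{}" j x f] assms
    by (simp add: partial_integral_empty cong: nn_integral_cong)
qed

text \<open>
  With \<open>d = card D\<close> and \<open>a = 1 / (d - 1)\<close>, one proves for all \<open>S \<subseteq> D\<close> that the integral of the
  product over the variables in \<open>S\<close> is at most the product of the \<open>a\<close>-th powers of the integrals of
  the \<open>f\<^sub>i\<close> over \<open>S \<union> {i}\<close>; the case \<open>S = D\<close> is the claim. When a variable \<open>j\<close> is added to \<open>S\<close>, the
  factor with index \<open>j\<close> is already independent of it, which leaves exactly \<open>d - 1\<close> factors, and their
  exponents \<open>a\<close> sum up to \<open>1\<close> as Hoelder's inequality requires.
\<close>

theorem nn_integral_Gagliardo:
  assumes D: "finite D" "card D \<ge> 2"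
    and f [measurable]: "\<And>i. i \<in> D \<Longrightarrow> f i \<in> borel_measurable (Pi\<^sub>M D M)"
  shows "(\<integral>\<^sup>+x. (\<Prod>i\<in>D. ennpowr (partial_integral D {i} (f i) x) (1 / (real (card D) - 1))) \<partial>Pi\<^sub>M D M)
    \<le> (\<Prod>i\<in>D. ennpowr (\<integral>\<^sup>+x. f i x \<partial>Pi\<^sub>M D M) (1 / (real (card D) - 1)))"
proof -
  define a where "a = 1 / (real (card D) - 1)"
  let ?P = "\<lambda>x. \<Prod>i\<in>D. ennpowr (partial_integral D {i} (f i) x) a"
  have apos: "a > 0" using D by (simp add: a_def)
  have m [measurable]: "partial_integral D T (f i) \<in> borel_measurable (Pi\<^sub>M D M)" if "T \<subseteq> D" "i \<in> D" for T i
    using that D f by (intro measurable_partial_integral)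
  have *: "partial_integral D S ?P x \<le> (\<Prod>i\<in>D. ennpowr (partial_integral D (insert i S) (f i) x) a)"
    if "S \<subseteq> D" "x \<in> space (Pi\<^sub>M D M)" for S x
  proof -
    have "finite S" using that D finite_subset by auto
    then show ?thesis using that
    proof (induction S arbitrary: x rule: finite_induct)
      case empty
      then show ?case by (simp add: partial_integral_empty)
    next
      case (insert j S)
      then have j: "j \<in> D" "S \<subseteq> D" by auto
      let ?h = "\<lambda>i. partial_integral D (insert i S) (f i)"
      have upd: "x(j := t) \<in> space (Pi\<^sub>M D M)" if "t \<in> space (M j)" for t
        using insert.prems that j by (auto simp: space_PiM PiE_def extensional_def)
      have up [measurable]: "(\<lambda>t. x(j := t)) \<in> M j \<rightarrow>\<^sub>M Pi\<^sub>M D M"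
        using j insert.prems by (intro measurable_fun_upd[where J = D]) auto
      have hm [measurable]: "(\<lambda>t. ?h i (x(j := t))) \<in> borel_measurable (M j)" if "i \<in> D" for i
        using j that by (intro measurable_compose[OF up] m) auto
      have Pm: "?P \<in> borel_measurable (Pi\<^sub>M D M)"
        by measurable
      have "partial_integral D (insert j S) ?P x = (\<integral>\<^sup>+t. partial_integral D S ?P (x(j := t)) \<partial>M j)"
        by (intro partial_integral_insert D j insert.hyps insert.prems Pm)
      also have "\<dots> \<le> (\<integral>\<^sup>+t. (\<Prod>i\<in>D. ennpowr (?h i (x(j := t))) a) \<partial>M j)"
        by (intro nn_integral_mono insert.IH j upd)
      also have "\<dots> = (\<integral>\<^sup>+t. ennpowr (?h j x) a * (\<Prod>i\<in>D - {j}. ennpowr (?h i (x(j := t))) a) \<partial>M j)"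
        by (simp add: prod.remove[OF D(1) j(1)] partial_integral_upd)
      also have "\<dots> = ennpowr (?h j x) a * (\<integral>\<^sup>+t. (\<Prod>i\<in>D - {j}. ennpowr (?h i (x(j := t))) a) \<partial>M j)"
        by (intro nn_integral_cmult) (use hm in measurable)
      also have "(\<integral>\<^sup>+t. (\<Prod>i\<in>D - {j}. ennpowr (?h i (x(j := t))) a) \<partial>M j)
          \<le> (\<Prod>i\<in>D - {j}. ennpowr (\<integral>\<^sup>+t. ?h i (x(j := t)) \<partial>M j) a)"
        using D j apos by (intro nn_integral_Hoelder) (auto simp: a_def of_nat_diff)
      also have "(\<Prod>i\<in>D - {j}. ennpowr (\<integral>\<^sup>+t. ?h i (x(j := t)) \<partial>M j) a)
          = (\<Prod>i\<in>D - {j}. ennpowr (partial_integral D (insert i (insert j S)) (f i) x) a)"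
      proof (intro prod.cong refl, goal_cases)
        case (1 i)
        then have "(\<integral>\<^sup>+t. ?h i (x(j := t)) \<partial>M j) = partial_integral D (insert j (insert i S)) (f i) x"
          using insert D by (intro partial_integral_insert[symmetric]) auto
        then show ?case by (simp add: insert_commute)
      qed
      also have "ennpowr (?h j x) a * \<dots> = (\<Prod>i\<in>D. ennpowr (partial_integral D (insert i (insert j S)) (f i) x) a)"
        by (simp add: prod.remove[OF D(1) j(1)])
      finally show ?case by (simp add: mult_left_mono)
    qed
  qed
  show ?thesis
  proof (cases "space (Pi\<^sub>M D M) = {}")
    case True
    then have "(\<integral>\<^sup>+x. ?P x \<partial>Pi\<^sub>M D M) = (\<integral>\<^sup>+x. 0 \<partial>Pi\<^sub>M D M)"
      using True by (intro nn_integral_cong) blast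
    then show ?thesis by (simp add: a_def)
  next
    case False
    then obtain x where "x \<in> space (Pi\<^sub>M D M)" by blast
    then have "partial_integral D D ?P x \<le> (\<Prod>i\<in>D. ennpowr (partial_integral D (insert i D) (f i) x) a)"
      by (rule *[OF subset_refl])
    also have "\<dots> = (\<Prod>i\<in>D. ennpowr (\<integral>\<^sup>+x. f i x \<partial>Pi\<^sub>M D M) a)"
      by (intro prod.cong refl) (simp add: insert_absorb partial_integral_all)
    finally show ?thesis unfolding partial_integral_all a_def .
  qed
qed

end

section \<open>Lebesgue norms of compactly supported functions\<close>

lemma integrable_continuous_compact_support:
  fixes f :: "'a::euclidean_space \<Rightarrow> real"
  assumes "continuous_on UNIV f" "compact K" "\<And>x. x \<notin> K \<Longrightarrow> f x = 0"
  shows "integrable lborel f"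
proof -
  have "integrable lborel (\<lambda>x. indicator K x *\<^sub>R f x)"
    using assms by (intro borel_integrable_compact) (auto intro: continuous_on_subset)
  moreover have "(\<lambda>x. indicator K x *\<^sub>R f x) = f" using assms(3) by (auto simp: indicator_def fun_eq_iff)
  ultimately show ?thesis by simp
qed

definition Lp_norm :: "real \<Rightarrow> ('a::euclidean_space \<Rightarrow> real) \<Rightarrow> real" where
  "Lp_norm p f = (\<integral>x. \<bar>f x\<bar> powr p \<partial>lborel) powr (1 / p)"

lemma Lp_norm_nonneg [simp]: "Lp_norm p f \<ge> 0"
  by (simp add: Lp_norm_def)

lemma Lp_norm_cmult:
  assumes "p > 0"
  shows "Lp_norm p (\<lambda>x. c * f x) = \<bar>c\<bar> * Lp_norm p f"
  using assms by (simp add: Lp_norm_def abs_mult powr_mult powr_powr)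

lemma continuous_on_abs_powr:
  fixes f :: "'a::topological_space \<Rightarrow> real"
  assumes "continuous_on UNIV f" "s > 0"
  shows "continuous_on UNIV (\<lambda>x. \<bar>f x\<bar> powr s)"
  using assms by (intro continuous_on_powr' continuous_intros) auto

lemma integrable_abs_powr_compact_support:
  fixes f :: "'a::euclidean_space \<Rightarrow> real"
  assumes "continuous_on UNIV f" "compact K" "\<And>x. x \<notin> K \<Longrightarrow> f x = 0" "s > 0"
  shows "integrable lborel (\<lambda>x. \<bar>f x\<bar> powr s)"
  using assms by (intro integrable_continuous_compact_support[where K = K] continuous_on_abs_powr) auto

text \<open>
  A continuous function that does not vanish identically differs from \<open>0\<close> on a nonempty open set,
  which has positive measure.
\<close>

lemma Lp_norm_pos:
  fixes f :: "'a::euclidean_space \<Rightarrow> real"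
  assumes f: "continuous_on UNIV f" "compact K" "\<And>x. x \<notin> K \<Longrightarrow> f x = 0" and "s > 0" "f z \<noteq> 0"
  shows "Lp_norm s f > 0"
proof -
  have op: "open {x. f x \<noteq> 0}"
    using open_Collect_neq[OF f(1) continuous_on_const[of UNIV 0]] .
  have [measurable]: "f \<in> borel_measurable borel" using f by (intro borel_measurable_continuous_onI)
  have "(\<integral>x. \<bar>f x\<bar> powr s \<partial>lborel) \<noteq> 0"
  proof
    assume "(\<integral>x. \<bar>f x\<bar> powr s \<partial>lborel) = 0"
    then have "AE x in lborel. \<bar>f x\<bar> powr s = 0"
      using integral_nonneg_eq_0_iff_AE[OF integrable_abs_powr_compact_support[OF f \<open>s > 0\<close>]] by simp
    then have "AE x in lborel. \<not> f x \<noteq> 0" by simp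
    then have "{x. f x \<noteq> 0} \<in> null_sets lborel"
      by (subst (asm) AE_iff_null) auto
    then have "negligible {x. f x \<noteq> 0}"
      by (simp add: negligible_iff_null_sets null_sets_completionI)
    then show False using open_not_negligible[OF op] \<open>f z \<noteq> 0\<close> by auto
  qed
  then show ?thesis by (simp add: Lp_norm_def)
qed

text \<open>
  A triangle inequality with a constant, from \<open>s + t \<le> 2 max s t\<close>; the constant is harmless in the
  application.
\<close>

lemma Lp_norm_le_add:
  fixes f g h :: "'a::euclidean_space \<Rightarrow> real"
  assumes "p \<ge> 1"
    and f: "continuous_on UNIV f" "\<And>x. x \<notin> K \<Longrightarrow> f x = 0"
    and g: "continuous_on UNIV g" "\<And>x. x \<notin> K \<Longrightarrow> g x = 0"
    and h: "continuous_on UNIV h" "\<And>x. x \<notin> K \<Longrightarrow> h x = 0" and K: "compact K"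
    and le: "\<And>x. \<bar>f x\<bar> \<le> \<bar>g x\<bar> + \<bar>h x\<bar>"
  shows "Lp_norm p f \<le> 4 * (Lp_norm p g + Lp_norm p h)"
proof -
  define X Y where "X = (\<integral>x. \<bar>g x\<bar> powr p \<partial>lborel)" and "Y = (\<integral>x. \<bar>h x\<bar> powr p \<partial>lborel)"
  have nn: "X \<ge> 0" "Y \<ge> 0" by (simp_all add: X_def Y_def)
  have int: "integrable lborel (\<lambda>x. \<bar>f x\<bar> powr p)" "integrable lborel (\<lambda>x. \<bar>g x\<bar> powr p)"
      "integrable lborel (\<lambda>x. \<bar>h x\<bar> powr p)"
    using assms by (auto intro!: integrable_abs_powr_compact_support[where K = K])
  have "\<bar>f x\<bar> powr p \<le> 2 powr p * (\<bar>g x\<bar> powr p + \<bar>h x\<bar> powr p)" for x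
  proof -
    have "\<bar>f x\<bar> powr p \<le> (2 * max \<bar>g x\<bar> \<bar>h x\<bar>) powr p"
      using le[of x] assms(1) by (intro powr_mono2) auto
    also have "\<dots> = 2 powr p * max \<bar>g x\<bar> \<bar>h x\<bar> powr p" by (simp add: powr_mult)
    also have "\<dots> \<le> 2 powr p * (\<bar>g x\<bar> powr p + \<bar>h x\<bar> powr p)"
      by (intro mult_left_mono) (auto simp: max_def)
    finally show ?thesis .
  qed
  then have "(\<integral>x. \<bar>f x\<bar> powr p \<partial>lborel) \<le> (\<integral>x. 2 powr p * (\<bar>g x\<bar> powr p + \<bar>h x\<bar> powr p) \<partial>lborel)"
    using int by (intro integral_mono) auto
  also have "\<dots> = 2 powr p * (X + Y)" using int by (simp add: X_def Y_def)
  finally have "Lp_norm p f \<le> (2 powr p * (X + Y)) powr (1 / p)"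
    unfolding Lp_norm_def using assms(1) by (intro powr_mono2) auto
  also have "\<dots> = 2 * (X + Y) powr (1 / p)" using nn assms(1) by (simp add: powr_mult powr_powr)
  also have "(X + Y) powr (1 / p) \<le> (2 * max X Y) powr (1 / p)"
    using nn assms(1) by (intro powr_mono2) auto
  also have "\<dots> = 2 powr (1 / p) * max X Y powr (1 / p)" using nn by (simp add: powr_mult)
  also have "\<dots> \<le> 2 * (Lp_norm p g + Lp_norm p h)"
  proof (rule mult_mono)
    show "2 powr (1 / p) \<le> (2::real)" using powr_mono[of "1/p" 1 "2::real"] assms(1) by simp
    show "max X Y powr (1 / p) \<le> Lp_norm p g + Lp_norm p h"
      by (auto simp: max_def Lp_norm_def X_def Y_def)
  qed auto
  finally show ?thesis by simp
qed

text \<open>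
  Hoelder's inequality for \<open>\<bar>f\<bar>\<^sup>q\<close> and \<open>\<bar>g\<bar>\<^sup>s\<close>, with exponents \<open>\<theta> r / q\<close> and \<open>(1 - \<theta>) r / s\<close>: the
  relation between \<open>q\<close>, \<open>r\<close> and \<open>s\<close> says that they sum up to \<open>1\<close>.
\<close>

lemma Lp_norm_interpolation:
  fixes f g :: "'a::euclidean_space \<Rightarrow> real"
  assumes f: "continuous_on UNIV f" "\<And>x. x \<notin> K \<Longrightarrow> f x = 0"
    and g: "continuous_on UNIV g" "\<And>x. x \<notin> K \<Longrightarrow> g x = 0" and K: "compact K"
    and \<theta>: "0 < \<theta>" "\<theta> < 1" and q: "q > 0" "s > 0" "r > 0" "1 / r = \<theta> / q + (1 - \<theta>) / s"
  shows "Lp_norm r (\<lambda>x. \<bar>f x\<bar> powr \<theta> * \<bar>g x\<bar> powr (1 - \<theta>)) \<le> Lp_norm q f powr \<theta> * Lp_norm s g powr (1 - \<theta>)"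
proof -
  define a b where "a = \<theta> * r / q" and "b = (1 - \<theta>) * r / s"
  have "a + b = r * (\<theta> / q + (1 - \<theta>) / s)" by (simp add: a_def b_def algebra_simps)
  then have "a + b = 1" using q(3) unfolding q(4)[symmetric] by simp
  moreover have "a > 0" "b > 0" using q \<theta> by (simp_all add: a_def b_def)
  ultimately have ab: "a > 0" "b > 0" "a + b = 1" by auto
  have qa: "q * a = \<theta> * r" "s * b = (1 - \<theta>) * r" using q by (auto simp: a_def b_def)
  have "(\<integral>x. \<bar>\<bar>f x\<bar> powr \<theta> * \<bar>g x\<bar> powr (1 - \<theta>)\<bar> powr r \<partial>lborel)
      = (\<integral>x. (\<bar>f x\<bar> powr q) powr a * (\<bar>g x\<bar> powr s) powr b \<partial>lborel)"
    by (simp add: powr_mult powr_powr abs_mult qa)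
  also have "\<dots> \<le> (\<integral>x. \<bar>f x\<bar> powr q \<partial>lborel) powr a * (\<integral>x. \<bar>g x\<bar> powr s \<partial>lborel) powr b"
    using assms by (intro integral_Hoelder ab integrable_abs_powr_compact_support[where K = K]) auto
  finally have "Lp_norm r (\<lambda>x. \<bar>f x\<bar> powr \<theta> * \<bar>g x\<bar> powr (1 - \<theta>))
      \<le> ((\<integral>x. \<bar>f x\<bar> powr q \<partial>lborel) powr a * (\<integral>x. \<bar>g x\<bar> powr s \<partial>lborel) powr b) powr (1 / r)"
    unfolding Lp_norm_def using q(3) by (intro powr_mono2) auto
  also have "\<dots> = Lp_norm q f powr \<theta> * Lp_norm s g powr (1 - \<theta>)"
    using q(1-3) by (simp add: Lp_norm_def powr_mult powr_powr a_def b_def)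
  finally show ?thesis .
qed

section \<open>The Gagliardo-Nirenberg-Sobolev inequality\<close>

lemma abs_le_nn_integral_deriv:
  fixes f f' :: "real \<Rightarrow> real"
  assumes f: "\<And>t. (f has_real_derivative f' t) (at t)" and f': "continuous_on UNIV f'"
    and "t0 \<le> s" "f t0 = 0"
  shows "ennreal \<bar>f s\<bar> \<le> (\<integral>\<^sup>+t. ennreal \<bar>f' t\<bar> \<partial>lborel)"
proof -
  have bi: "has_bochner_integral lborel (\<lambda>x. f' x * indicator {t0..s} x) (f s - f t0)"
    using assms by (intro has_bochner_integral_FTC_Icc_real)
      (auto simp: continuous_on_eq_continuous_at)
  then have "ennreal \<bar>f s\<bar> = ennreal (norm (\<integral>x. f' x * indicator {t0..s} x \<partial>lborel))"
    using assms by (simp add: has_bochner_integral_integral_eq)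
  also have "\<dots> \<le> (\<integral>\<^sup>+x. ennreal (norm (f' x * indicator {t0..s} x)) \<partial>lborel)"
    using bi by (intro integral_norm_bound_ennreal) (rule integrable.intros)
  also have "\<dots> \<le> (\<integral>\<^sup>+t. ennreal \<bar>f' t\<bar> \<partial>lborel)"
    by (intro nn_integral_mono) (auto simp: indicator_def)
  finally show ?thesis .
qed

lemma abs_le_nn_integral_line:
  fixes v w :: "'a::euclidean_space \<Rightarrow> real"
  assumes b: "b \<in> Basis"
    and v: "\<And>y. ((\<lambda>h. v (y + h *\<^sub>R b)) has_real_derivative w y) (at 0)"
    and w: "continuous_on UNIV w" and K: "bounded K" "\<And>y. y \<notin> K \<Longrightarrow> v y = 0"
  shows "ennreal \<bar>v x\<bar> \<le> (\<integral>\<^sup>+t. ennreal \<bar>w (x + (t - s) *\<^sub>R b)\<bar> \<partial>lborel)"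
proof -
  let ?l = "\<lambda>t. x + (t - s) *\<^sub>R b"
  obtain R where R: "\<And>y. y \<in> K \<Longrightarrow> norm y \<le> R" "R > 0" using K(1) bounded_pos by metis
  \<comment> \<open>A point on the line that lies before \<open>s\<close> and is too far away to belong to \<open>K\<close>.\<close>
  define t0 where "t0 = s - (R + norm x + 1)"
  have "norm ((t0 - s) *\<^sub>R b) - norm x \<le> norm (?l t0)"
    using norm_triangle_ineq2[of "(t0 - s) *\<^sub>R b" "- x"] by (simp add: add.commute)
  moreover have "norm ((t0 - s) *\<^sub>R b) = R + norm x + 1"
    using b by (simp add: t0_def) (use R(2) norm_ge_zero[of x] in linarith)
  ultimately have "?l t0 \<notin> K" using R(1)[of "?l t0"] by auto
  then have z: "v (?l t0) = 0" by (rule K)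
  have "((\<lambda>t. v (?l t)) has_real_derivative w (?l t)) (at t)" for t
  proof -
    have "((\<lambda>h. v (?l (h + t))) has_real_derivative w (?l t)) (at 0)"
      using v[of "?l t"] by (simp add: algebra_simps)
    then show ?thesis using DERIV_shift[of "\<lambda>t. v (?l t)" "w (?l t)" 0 t] by simp
  qed
  moreover have "continuous_on UNIV (\<lambda>t. w (?l t))"
    by (intro continuous_on_compose2[OF w] continuous_intros) auto
  moreover have "t0 \<le> s" using R(2) norm_ge_zero[of x] unfolding t0_def by linarith
  ultimately have "ennreal \<bar>v (?l s)\<bar> \<le> (\<integral>\<^sup>+t. ennreal \<bar>w (?l t)\<bar> \<partial>lborel)"
    using z by (intro abs_le_nn_integral_deriv[where f = "\<lambda>t. v (?l t)"])
  then show ?thesis by simp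
qed

text \<open>
  The case \<open>p = 1\<close>. Each of the \<open>d\<close> factors in
  \<open>\<bar>v\<bar>\<^bsup>d/(d-1)\<^esup> = (\<bar>v\<bar>\<^bsup>1/(d-1)\<^esup>)\<^sup>d\<close> is estimated by the integral of another partial derivative along
  its coordinate line, and Gagliardo's lemma integrates the resulting product. Lebesgue measure is
  treated as the image of the product measure under \<open>X\<close>.
\<close>

theorem nn_integral_Gagliardo_Nirenberg_Sobolev_1:
  fixes v :: "'a::euclidean_space \<Rightarrow> real" and v' :: "'a \<Rightarrow> 'a \<Rightarrow> real"
  assumes d: "DIM('a) \<ge> 2"
    and v: "\<And>b y. b \<in> Basis \<Longrightarrow> ((\<lambda>h. v (y + h *\<^sub>R b)) has_real_derivative v' b y) (at 0)"
    and cont: "continuous_on UNIV v" "\<And>b. b \<in> Basis \<Longrightarrow> continuous_on UNIV (v' b)"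
    and K: "bounded K" "\<And>y. y \<notin> K \<Longrightarrow> v y = 0"
  shows "(\<integral>\<^sup>+x. ennreal (\<bar>v x\<bar> powr (real DIM('a) / (real DIM('a) - 1))) \<partial>lborel)
    \<le> (\<Prod>b\<in>Basis. ennpowr (\<integral>\<^sup>+x. ennreal \<bar>v' b x\<bar> \<partial>lborel) (1 / (real DIM('a) - 1)))"
proof -
  let ?d = "real DIM('a)" and ?P = "Pi\<^sub>M Basis (\<lambda>_. lborel) :: ('a \<Rightarrow> real) measure"
  let ?a = "1 / (?d - 1)"
  interpret product_sigma_finite "\<lambda>_::'a. lborel :: real measure"
    by standard
  define X where "X x = (\<Sum>b\<in>Basis. x b *\<^sub>R b)" for x :: "'a \<Rightarrow> real"
  have [measurable]: "X \<in> ?P \<rightarrow>\<^sub>M borel" unfolding X_def[abs_def] by measurable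
  have [measurable]: "v \<in> borel_measurable borel" "\<And>b. b \<in> Basis \<Longrightarrow> v' b \<in> borel_measurable borel"
    using cont by (auto intro: borel_measurable_continuous_onI)
  have lborel: "(lborel :: 'a measure) = distr ?P borel X"
    unfolding X_def[abs_def] by (rule lborel_eq)
  define f where "f b x = ennreal \<bar>v' b (X x)\<bar>" for b x
  have f [measurable]: "f b \<in> borel_measurable ?P" if "b \<in> Basis" for b
    unfolding f_def[abs_def] using that by measurable
  have upd: "X (x(b := t)) = X x + (t - x b) *\<^sub>R b" if "b \<in> Basis" for x b t
  proof -
    have "X (x(b := t)) = t *\<^sub>R b + (\<Sum>c\<in>Basis - {b}. x c *\<^sub>R c)"
      unfolding X_def using that by (subst sum.remove[of _ b]) auto
    moreover have "X x = x b *\<^sub>R b + (\<Sum>c\<in>Basis - {b}. x c *\<^sub>R c)"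
      unfolding X_def using that by (subst sum.remove[of _ b]) auto
    ultimately show ?thesis by (simp add: algebra_simps)
  qed
  have le: "ennreal (\<bar>v (X x)\<bar> powr (?d / (?d - 1))) \<le> (\<Prod>b\<in>Basis. ennpowr (partial_integral Basis {b} (f b) x) ?a)"
    if "x \<in> space ?P" for x
  proof -
    have "ennreal (\<bar>v (X x)\<bar> powr (?d / (?d - 1))) = ennreal ((\<bar>v (X x)\<bar> powr ?a) ^ DIM('a))"
      by (subst powr_realpow'[symmetric]) (simp_all add: powr_powr)
    also have "\<dots> = (\<Prod>b\<in>(Basis::'a set). ennpowr (ennreal \<bar>v (X x)\<bar>) ?a)"
      by (simp add: ennpowr_ennreal ennreal_power)
    also have "\<dots> \<le> (\<Prod>b\<in>Basis. ennpowr (partial_integral Basis {b} (f b) x) ?a)"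
    proof (rule prod_mono_ennreal)
      fix b :: 'a assume b: "b \<in> Basis"
      have "ennreal \<bar>v (X x)\<bar> \<le> (\<integral>\<^sup>+t. ennreal \<bar>v' b (X x + (t - x b) *\<^sub>R b)\<bar> \<partial>lborel)"
        by (rule abs_le_nn_integral_line[OF b v[OF b] cont(2)[OF b] K])
      also have "\<dots> = partial_integral Basis {b} (f b) x"
        using b that by (subst partial_integral_singleton) (simp_all add: f_def upd)
      finally show "ennpowr (ennreal \<bar>v (X x)\<bar>) ?a \<le> ennpowr (partial_integral Basis {b} (f b) x) ?a"
        using d by (intro ennpowr_mono) auto
    qed
    finally show ?thesis .
  qed
  have "(\<integral>\<^sup>+x. ennreal (\<bar>v x\<bar> powr (?d / (?d - 1))) \<partial>lborel) = (\<integral>\<^sup>+x. ennreal (\<bar>v (X x)\<bar> powr (?d / (?d - 1))) \<partial>?P)"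
    unfolding lborel by (rule nn_integral_distr) measurable
  also have "\<dots> \<le> (\<integral>\<^sup>+x. (\<Prod>b\<in>Basis. ennpowr (partial_integral Basis {b} (f b) x) ?a) \<partial>?P)"
    by (intro nn_integral_mono le)
  also have "\<dots> \<le> (\<Prod>b\<in>Basis. ennpowr (\<integral>\<^sup>+x. f b x \<partial>?P) ?a)"
    using nn_integral_Gagliardo[of Basis f] d f by simp
  also have "\<dots> = (\<Prod>b\<in>Basis. ennpowr (\<integral>\<^sup>+x. ennreal \<bar>v' b x\<bar> \<partial>lborel) ?a)"
    unfolding lborel f_def by (intro prod.cong refl arg_cong2[where f = ennpowr] nn_integral_distr[symmetric]) measurable
  finally show ?thesis .
qed

lemma directional_derivative_eq_0_outside:
  fixes v :: "'a::real_normed_vector \<Rightarrow> real"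
  assumes "closed K" "\<And>y. y \<notin> K \<Longrightarrow> v y = 0" "x \<notin> K"
    and "((\<lambda>h. v (x + h *\<^sub>R b)) has_real_derivative D) (at 0)"
  shows "D = 0"
proof -
  have "open ((\<lambda>h. x + h *\<^sub>R b) -` (- K))"
    using assms(1) by (intro open_vimage) (auto intro!: continuous_intros)
  from eventually_nhds_in_open[OF this, of 0] have "\<forall>\<^sub>F h in nhds 0. x + h *\<^sub>R b \<in> - K"
    using assms(3) by simp
  then have ev: "\<forall>\<^sub>F h in nhds 0. v (x + h *\<^sub>R b) = 0"
    by eventually_elim (use assms(2) in auto)
  have "((\<lambda>h. 0) has_real_derivative D) (at 0)"
    using assms(4) DERIV_cong_ev[OF refl ev refl] by simp
  then show ?thesis by (metis DERIV_const DERIV_unique)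
qed

lemma integral_Gagliardo_Nirenberg_Sobolev_1:
  fixes v :: "'a::euclidean_space \<Rightarrow> real" and v' :: "'a \<Rightarrow> 'a \<Rightarrow> real"
  assumes d: "DIM('a) \<ge> 2"
    and v: "\<And>b y. b \<in> Basis \<Longrightarrow> ((\<lambda>h. v (y + h *\<^sub>R b)) has_real_derivative v' b y) (at 0)"
    and cont: "continuous_on UNIV v" "\<And>b. b \<in> Basis \<Longrightarrow> continuous_on UNIV (v' b)"
    and K: "compact K" "\<And>y. y \<notin> K \<Longrightarrow> v y = 0"
  shows "(\<integral>x. \<bar>v x\<bar> powr (real DIM('a) / (real DIM('a) - 1)) \<partial>lborel)
    \<le> (\<Prod>b\<in>Basis. (\<integral>x. \<bar>v' b x\<bar> \<partial>lborel) powr (1 / (real DIM('a) - 1)))"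
proof -
  have K': "v' b y = 0" if "b \<in> Basis" "y \<notin> K" for b y
    using directional_derivative_eq_0_outside[OF compact_imp_closed[OF K(1)] K(2) that(2) v[OF that(1)]] .
  have int: "integrable lborel (\<lambda>x. \<bar>v' b x\<bar>)" if "b \<in> Basis" for b
    using that K K' cont by (intro integrable_abs integrable_continuous_compact_support[where K = K]) auto
  have "ennreal (\<integral>x. \<bar>v x\<bar> powr (real DIM('a) / (real DIM('a) - 1)) \<partial>lborel)
      = (\<integral>\<^sup>+x. ennreal (\<bar>v x\<bar> powr (real DIM('a) / (real DIM('a) - 1))) \<partial>lborel)"
    using d K cont by (intro nn_integral_eq_integral[symmetric] integrable_abs_powr_compact_support[where K = K]) auto
  also have "\<dots> \<le> (\<Prod>b\<in>Basis. ennpowr (\<integral>\<^sup>+x. ennreal \<bar>v' b x\<bar> \<partial>lborel) (1 / (real DIM('a) - 1)))"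
    by (rule nn_integral_Gagliardo_Nirenberg_Sobolev_1[OF d v cont compact_imp_bounded[OF K(1)] K(2)])
  also have "\<dots> = (\<Prod>b\<in>Basis. ennreal ((\<integral>x. \<bar>v' b x\<bar> \<partial>lborel) powr (1 / (real DIM('a) - 1))))"
    by (intro prod.cong refl) (simp add: nn_integral_eq_integral int ennpowr_ennreal)
  also have "\<dots> = ennreal (\<Prod>b\<in>Basis. (\<integral>x. \<bar>v' b x\<bar> \<partial>lborel) powr (1 / (real DIM('a) - 1)))"
    by (rule prod_ennreal) simp
  finally show ?thesis by (simp add: prod_nonneg)
qed

text \<open>
  The odd power is the more convenient \<open>C\<^sup>1\<close> function of absolute value \<open>\<bar>s\<bar>\<^sup>c\<close>, as no sign occurs in
  its derivative. At \<open>s = 0\<close> the difference quotient is \<open>\<bar>h\<bar>\<^bsup>c-1\<^esup>\<close>, which tends to \<open>0\<close> because \<open>c > 1\<close>.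
\<close>

lemma has_real_derivative_signed_powr:
  fixes c :: real
  assumes "c > 1"
  shows "((\<lambda>s. sgn s * \<bar>s\<bar> powr c) has_real_derivative c * \<bar>s\<bar> powr (c - 1)) (at s)"
proof -
  consider "s > 0" | "s < 0" | "s = 0" by linarith
  then show ?thesis
  proof cases
    case 1
    have ev: "\<forall>\<^sub>F t in nhds s. sgn t * \<bar>t\<bar> powr c = t powr c"
      using 1 by (intro eventually_nhds_in_open[THEN eventually_mono, of "{0<..}"]) auto
    have "((\<lambda>t. t powr c) has_real_derivative c * s powr (c - 1)) (at s)"
      using 1 by (auto intro!: derivative_eq_intros simp: powr_diff)
    then show ?thesis using 1 DERIV_cong_ev[OF refl ev refl] by simp
  next
    case 2
    have ev: "\<forall>\<^sub>F t in nhds s. sgn t * \<bar>t\<bar> powr c = - ((- t) powr c)"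
      using 2 by (intro eventually_nhds_in_open[THEN eventually_mono, of "{..<0}"]) auto
    have "((\<lambda>t. - ((- t) powr c)) has_real_derivative c * (- s) powr (c - 1)) (at s)"
      using 2 by (auto intro!: derivative_eq_intros simp: powr_diff)
    then show ?thesis using 2 DERIV_cong_ev[OF refl ev refl] by simp
  next
    case 3
    have "((\<lambda>h. \<bar>h\<bar> powr (c - 1)) \<longlongrightarrow> \<bar>0::real\<bar> powr (c - 1)) (at 0)"
      using assms by (intro tendsto_powr' tendsto_rabs tendsto_const tendsto_ident_at) auto
    moreover have "(sgn h * \<bar>h\<bar> powr c) / h = \<bar>h\<bar> powr (c - 1)" if "h \<noteq> 0" for h :: real
      using that by (auto simp: powr_diff sgn_if abs_if)
    then have "\<forall>\<^sub>F h in at 0. (sgn h * \<bar>h\<bar> powr c) / h = \<bar>h\<bar> powr (c - 1)"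
      by (simp add: eventually_at_filter)
    ultimately have "((\<lambda>h. (sgn h * \<bar>h\<bar> powr c) / h) \<longlongrightarrow> \<bar>0::real\<bar> powr (c - 1)) (at 0)"
      by (subst tendsto_cong)
    then show ?thesis using 3 assms by (simp add: has_field_derivative_iff)
  qed
qed

text \<open>
  Let \<open>s = d p / (d - p)\<close> and \<open>c = p (d - 1) / (d - p)\<close>. The case \<open>p = 1\<close>, applied to
  \<open>v = sgn u \<bar>u\<bar>\<^sup>c\<close>, bounds the integral \<open>A\<close> of \<open>\<bar>v\<bar>\<^bsup>d/(d-1)\<^esup> = \<bar>u\<bar>\<^sup>s\<close>. Hoelder's inequality separates
  the two factors of \<open>\<bar>\<partial>\<^sub>b v\<bar> = c \<bar>u\<bar>\<^bsup>c-1\<^esup> \<bar>\<partial>\<^sub>b u\<bar>\<close>; as \<open>c - 1 = s (p - 1) / p\<close>, the first one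
  contributes \<open>A\<^bsup>(p-1)/p\<^esup>\<close>, which is smaller than the power \<open>A\<^bsup>(d-1)/d\<^esup>\<close> on the left and can be
  cancelled. What remains on the left is \<open>A\<^bsup>1/s\<^esup>\<close>, the norm of \<open>u\<close>.
\<close>

theorem Gagliardo_Nirenberg_Sobolev:
  fixes u :: "'a::euclidean_space \<Rightarrow> real" and u' :: "'a \<Rightarrow> 'a \<Rightarrow> real"
  assumes d: "DIM('a) \<ge> 2" and p: "1 \<le> p" "p < real DIM('a)"
    and u: "\<And>b y. b \<in> Basis \<Longrightarrow> ((\<lambda>h. u (y + h *\<^sub>R b)) has_real_derivative u' b y) (at 0)"
    and cont: "continuous_on UNIV u" "\<And>b. b \<in> Basis \<Longrightarrow> continuous_on UNIV (u' b)"
    and K: "compact K" "\<And>y. y \<notin> K \<Longrightarrow> u y = 0"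
  shows "Lp_norm (real DIM('a) * p / (real DIM('a) - p)) u
    \<le> p * (real DIM('a) - 1) / (real DIM('a) - p) * (\<Sum>b\<in>Basis. Lp_norm p (u' b))"
proof -
  let ?d = "real DIM('a)"
  define s where "s = ?d * p / (?d - p)"
  define c where "c = p * (?d - 1) / (?d - p)"
  define A where "A = (\<integral>x. \<bar>u x\<bar> powr s \<partial>lborel)"
  define W where "W = (\<Sum>b\<in>Basis. Lp_norm p (u' b))"
  define Z where "Z = c * A powr ((p - 1) / p) * W"
  have d1: "?d > 1" using d by simp
  have s: "s > 0" using p by (simp add: s_def)
  have c: "c > 0" using p d1 by (simp add: c_def)
  have cs: "c * (?d / (?d - 1)) = s" using d1 by (simp add: c_def s_def)
  have W: "Lp_norm p (u' b) \<le> W" if "b \<in> Basis" for b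
    unfolding W_def using that by (intro member_le_sum) auto
  have W0: "W \<ge> 0" unfolding W_def by (intro sum_nonneg) simp
  have Z0: "Z \<ge> 0" using c W0 by (simp add: Z_def)
  have u'0: "u' b y = 0" if "b \<in> Basis" "y \<notin> K" for b y
    using directional_derivative_eq_0_outside[OF compact_imp_closed[OF K(1)] K(2) that(2) u[OF that(1)]] .
  have "A \<ge> 0" by (simp add: A_def)
  have "A powr (1 / s) \<le> c * W"
  proof (cases "A = 0")
    case True
    then show ?thesis using c W0 by simp
  next
    case False
    then have A: "A > 0" using \<open>A \<ge> 0\<close> by simp
    \<comment> \<open>For \<open>p = 1\<close> the exponent \<open>c\<close> is \<open>1\<close>, where the odd power is linear, and \<open>v = u\<close>.\<close>
    obtain v v' where v: "\<And>b y. b \<in> Basis \<Longrightarrow> ((\<lambda>h. v (y + h *\<^sub>R b)) has_real_derivative v' b y) (at 0)"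
        "continuous_on UNIV v" "\<And>b. b \<in> Basis \<Longrightarrow> continuous_on UNIV (v' b)" "\<And>y. y \<notin> K \<Longrightarrow> v y = 0"
        "\<And>x. \<bar>v x\<bar> powr (?d / (?d - 1)) = \<bar>u x\<bar> powr s" "\<And>b. b \<in> Basis \<Longrightarrow> (\<integral>x. \<bar>v' b x\<bar> \<partial>lborel) \<le> Z"
    proof (cases "p = 1")
      case True
      have "(\<integral>x. \<bar>u' b x\<bar> \<partial>lborel) \<le> Z" if "b \<in> Basis" for b
        using W[OF that] True A d1 by (simp add: Z_def c_def Lp_norm_def)
      moreover have "\<bar>u x\<bar> powr (?d / (?d - 1)) = \<bar>u x\<bar> powr s" for x
        using True cs d1 by (simp add: c_def)
      ultimately show ?thesis using that[OF u cont K(2)] by blast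
    next
      case False
      then have p1: "p > 1" using p by simp
      have c1: "c > 1"
      proof -
        have "?d - p < p * (?d - 1)" using p1 d1 mult_strict_right_mono[of 1 p ?d] by (simp add: algebra_simps)
        then show ?thesis using p by (simp add: c_def field_simps)
      qed
      have cp: "c - 1 = s * ((p - 1) / p)"
        using p by (simp add: c_def s_def field_simps)
      define v where "v y = sgn (u y) * \<bar>u y\<bar> powr c" for y
      define v' where "v' b y = c * \<bar>u y\<bar> powr (c - 1) * u' b y" for b y
      have v1: "((\<lambda>h. v (y + h *\<^sub>R b)) has_real_derivative v' b y) (at 0)" if "b \<in> Basis" for b y
        unfolding v_def v'_def
        using DERIV_chain2[OF _ u[OF that], of "\<lambda>s. sgn s * \<bar>s\<bar> powr c" _ y]
          has_real_derivative_signed_powr[OF c1, of "u y"] by simp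
      have v2: "continuous_on UNIV v"
      proof -
        have "isCont (\<lambda>s::real. sgn s * \<bar>s\<bar> powr c) t" for t
          using has_real_derivative_signed_powr[OF c1] DERIV_isCont by blast
        then have "continuous_on UNIV (\<lambda>s::real. sgn s * \<bar>s\<bar> powr c)"
          by (simp add: continuous_at_imp_continuous_on)
        from continuous_on_compose2[OF this cont(1)] show ?thesis by (simp add: v_def[abs_def])
      qed
      have v3: "continuous_on UNIV (v' b)" if "b \<in> Basis" for b
        unfolding v'_def[abs_def] using c1 cont that
        by (intro continuous_on_mult continuous_on_const continuous_on_abs_powr) auto
      have v4: "v y = 0" if "y \<notin> K" for y using K(2)[OF that] by (simp add: v_def)
      have v5: "\<bar>v x\<bar> powr (?d / (?d - 1)) = \<bar>u x\<bar> powr s" for x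
      proof -
        have "\<bar>v x\<bar> = \<bar>u x\<bar> powr c" by (auto simp: v_def abs_mult sgn_if)
        then show ?thesis by (simp add: powr_powr cs del: times_divide_eq_right)
      qed
      have v6: "(\<integral>x. \<bar>v' b x\<bar> \<partial>lborel) \<le> Z" if b: "b \<in> Basis" for b
      proof -
        have "(\<integral>x. \<bar>v' b x\<bar> \<partial>lborel)
            = c * (\<integral>x. (\<bar>u x\<bar> powr s) powr ((p - 1) / p) * (\<bar>u' b x\<bar> powr p) powr (1 / p) \<partial>lborel)"
          using c p by (simp add: v'_def abs_mult powr_powr cp mult.assoc)
        also have "\<dots> \<le> c * (A powr ((p - 1) / p) * (\<integral>x. \<bar>u' b x\<bar> powr p \<partial>lborel) powr (1 / p))"
          unfolding A_def using c p1 s K u'0 cont b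
          by (intro mult_left_mono integral_Hoelder integrable_abs_powr_compact_support[where K = K])
            (auto simp: diff_divide_distrib)
        also have "\<dots> = c * A powr ((p - 1) / p) * Lp_norm p (u' b)" by (simp add: Lp_norm_def)
        also have "\<dots> \<le> Z" unfolding Z_def using c by (intro mult_left_mono W b) auto
        finally show ?thesis .
      qed
      show ?thesis by (rule that[OF v1 v2 v3 v4 v5 v6])
    qed
    have "A = (\<integral>x. \<bar>v x\<bar> powr (?d / (?d - 1)) \<partial>lborel)" by (simp add: A_def v)
    also have "\<dots> \<le> (\<Prod>b\<in>(Basis::'a set). (\<integral>x. \<bar>v' b x\<bar> \<partial>lborel) powr (1 / (?d - 1)))"
      by (rule integral_Gagliardo_Nirenberg_Sobolev_1[OF d v(1-3) K(1) v(4)])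
    also have "\<dots> \<le> (\<Prod>b\<in>(Basis::'a set). Z powr (1 / (?d - 1)))"
      using d1 v(6) by (intro prod_mono conjI powr_mono2) auto
    also have "\<dots> = Z powr (?d / (?d - 1))"
      using Z0 by (simp, subst powr_realpow'[symmetric]) (simp_all add: powr_powr)
    finally have "A powr ((?d - 1) / ?d) \<le> (Z powr (?d / (?d - 1))) powr ((?d - 1) / ?d)"
      using A d1 by (intro powr_mono2) auto
    also have "\<dots> = Z" using Z0 d1 by (simp add: powr_powr)
    finally have le: "A powr ((?d - 1) / ?d) \<le> Z" .
    have "(?d - 1) / ?d = 1 / s + (p - 1) / p"
      using p by (simp add: s_def field_simps)
    then have "A powr (1 / s) * A powr ((p - 1) / p) \<le> c * W * A powr ((p - 1) / p)"
      using le by (simp add: powr_add Z_def mult.commute mult.left_commute)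
    then show ?thesis using A by (simp add: mult_le_cancel_right)
  qed
  then show ?thesis by (simp add: Lp_norm_def A_def s_def c_def W_def)
qed

section \<open>Weighted inequalities on hyperboloids\<close>

lemma continuous_on_hyp_weight_powr:
  assumes "\<tau> > 0"
  shows "continuous_on UNIV (\<lambda>x::real^'n. hyp_weight \<tau> x powr c)"
proof (rule continuous_on_powr)
  show "continuous_on UNIV (hyp_weight \<tau> :: real^'n \<Rightarrow> real)"
    unfolding hyp_weight_def[abs_def] by (intro continuous_intros)
  show "\<forall>x\<in>UNIV. hyp_weight \<tau> (x::real^'n) \<noteq> 0"
    using hyp_weight_pos[OF assms] by (metis less_irrefl)
qed (rule continuous_on_const)

lemma L_norm_eq_Lp_norm:
  fixes u :: "real^'n \<Rightarrow> real"
  assumes "\<tau> > 0" "s > 0" and u: "continuous_on UNIV u"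
  shows "L_norm \<tau> s (1 + c * s) u = \<tau> powr (1 / s) * Lp_norm s (\<lambda>x. hyp_weight \<tau> x powr c * u x)"
proof -
  let ?w = "hyp_weight \<tau> :: real^'n \<Rightarrow> real"
  have w: "?w x > 0" for x by (rule hyp_weight_pos[OF assms(1)])
  have [measurable]: "u \<in> borel_measurable borel" using u by (rule borel_measurable_continuous_onI)
  have wm: "(\<lambda>x. ?w x powr c) \<in> borel_measurable borel" for c
    by (intro borel_measurable_continuous_onI continuous_on_hyp_weight_powr assms)
  have [measurable]: "?w \<in> borel_measurable borel"
    using wm[of 1] w by (simp add: less_imp_le)
  have "?w x powr (1 + c * s) * \<bar>u x\<bar> powr s * (\<tau> / ?w x) = \<tau> * \<bar>?w x powr c * u x\<bar> powr s" for x
    using w[of x] by (simp add: powr_add powr_mult powr_powr abs_mult)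
  then have "(LINT x|hyp_vol \<tau>. ?w x powr (1 + c * s) * \<bar>u x\<bar> powr s)
      = (\<integral>x. \<tau> * \<bar>?w x powr c * u x\<bar> powr s \<partial>lborel)"
    unfolding hyp_vol_def using w assms(1)
    by (subst integral_density) (auto simp: mult.commute less_imp_le intro!: AE_I2)
  then show ?thesis
    using assms by (simp add: L_norm_def Lp_norm_def powr_mult)
qed

lemma hyp_weight_directional_derivative:
  fixes x b :: "real^'n"
  assumes "\<tau> > 0" "b \<in> Basis"
  shows "((\<lambda>h. hyp_weight \<tau> (x + h *\<^sub>R b)) has_real_derivative (x \<bullet> b) / hyp_weight \<tau> x) (at 0)"
proof -
  have w: "hyp_weight \<tau> x > 0" by (rule hyp_weight_pos[OF assms(1)])
  have e: "(norm (x + h *\<^sub>R b))\<^sup>2 = (norm x)\<^sup>2 + 2 * h * (x \<bullet> b) + h\<^sup>2" for h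
    using assms(2) by (simp add: power2_norm_eq_inner inner_add_left inner_add_right inner_commute[of b x])
      (simp add: power2_eq_square algebra_simps)
  have "((\<lambda>h. sqrt (\<tau>\<^sup>2 + ((norm x)\<^sup>2 + 2 * h * (x \<bullet> b) + h\<^sup>2))) has_real_derivative (x \<bullet> b) / hyp_weight \<tau> x) (at 0)"
    using w by (auto intro!: derivative_eq_intros simp: hyp_weight_def divide_simps)
  then show ?thesis unfolding hyp_weight_def[of \<tau> "x + _ *\<^sub>R _"] e .
qed

lemma abs_inner_Basis_le_hyp_weight:
  assumes "b \<in> Basis"
  shows "\<bar>x \<bullet> b\<bar> \<le> hyp_weight \<tau> x"
proof -
  have "\<bar>x \<bullet> b\<bar> \<le> norm x" using Basis_le_norm[OF assms] .
  also have "\<dots> \<le> hyp_weight \<tau> x" unfolding hyp_weight_def by (rule real_le_rsqrt) simp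
  finally show ?thesis .
qed

text \<open>
  The Sobolev inequality for \<open>w\<^sup>\<alpha> u\<close>. Its derivative in direction \<open>b\<close> is
  \<open>w\<^sup>\<alpha> \<partial>\<^sub>b u + \<alpha> w\<^bsup>\<alpha>-2\<^esup> (x \<bullet> b) u\<close>, and \<open>\<bar>x \<bullet> b\<bar> \<le> w\<close> turns the second term into
  \<open>\<bar>\<alpha>\<bar> w\<^bsup>\<alpha>-1\<^esup> \<bar>u\<bar>\<close>.
\<close>

lemma weighted_Sobolev:
  fixes u :: "real^'n \<Rightarrow> real" and u' :: "real^'n \<Rightarrow> real^'n \<Rightarrow> real"
  assumes d: "CARD('n) \<ge> 2" and p: "1 \<le> p" "p < real CARD('n)" and \<tau>: "\<tau> > 0"
    and u: "\<And>b y. b \<in> Basis \<Longrightarrow> ((\<lambda>h. u (y + h *\<^sub>R b)) has_real_derivative u' b y) (at 0)"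
    and cont: "continuous_on UNIV u" "\<And>b. b \<in> Basis \<Longrightarrow> continuous_on UNIV (u' b)"
    and K: "compact K" "\<And>y. y \<notin> K \<Longrightarrow> u y = 0"
  defines "\<gamma> \<equiv> p * (real CARD('n) - 1) / (real CARD('n) - p)"
  shows "Lp_norm (sobolev_conj CARD('n) p) (\<lambda>x. hyp_weight \<tau> x powr \<alpha> * u x)
    \<le> \<gamma> * (\<Sum>b\<in>Basis. 4 * (Lp_norm p (\<lambda>x. hyp_weight \<tau> x powr \<alpha> * u' b x)
        + \<bar>\<alpha>\<bar> * Lp_norm p (\<lambda>x. hyp_weight \<tau> x powr (\<alpha> - 1) * u x)))"
proof -
  let ?w = "hyp_weight \<tau> :: real^'n \<Rightarrow> real"
  have w: "?w x > 0" for x by (rule hyp_weight_pos[OF \<tau>])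
  define v where "v x = ?w x powr \<alpha> * u x" for x
  define g where "g b x = ?w x powr \<alpha> * u' b x + \<alpha> * ?w x powr (\<alpha> - 2) * (x \<bullet> b) * u x" for b x
  have cw: "continuous_on UNIV (\<lambda>x. ?w x powr c)" for c by (rule continuous_on_hyp_weight_powr[OF \<tau>])
  have u'0: "u' b y = 0" if "b \<in> Basis" "y \<notin> K" for b y
    using directional_derivative_eq_0_outside[OF compact_imp_closed[OF K(1)] K(2) that(2) u[OF that(1)]] .
  have v_deriv: "((\<lambda>h. v (x + h *\<^sub>R b)) has_real_derivative g b x) (at 0)" if b: "b \<in> Basis" for b x
  proof -
    have w2: "?w x powr (\<alpha> - 2) = ?w x powr (\<alpha> - 1) / ?w x"
      using w[of x] powr_diff[of "?w x" "\<alpha> - 1" 1] by simp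
    have "((\<lambda>h. ?w (x + h *\<^sub>R b) powr \<alpha>) has_real_derivative
        \<alpha> * ?w x powr (\<alpha> - 1) * ((x \<bullet> b) / ?w x)) (at 0)"
      using DERIV_fun_powr[OF hyp_weight_directional_derivative[OF \<tau> b, of x], of \<alpha>] w[of x] by simp
    from DERIV_mult[OF this u[OF b, of x]]
    have "((\<lambda>h. v (x + h *\<^sub>R b)) has_real_derivative
       \<alpha> * ?w x powr (\<alpha> - 1) * ((x \<bullet> b) / ?w x) * u x + u' b x * ?w x powr \<alpha>) (at 0)"
      by (simp add: v_def)
    moreover have "\<alpha> * ?w x powr (\<alpha> - 1) * ((x \<bullet> b) / ?w x) * u x + u' b x * ?w x powr \<alpha> = g b x"
      by (simp add: g_def w2)
    ultimately show ?thesis by simp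
  qed
  have cg: "continuous_on UNIV (g b)" if "b \<in> Basis" for b
    unfolding g_def[abs_def] using cont that by (intro continuous_intros cw) auto
  have cv: "continuous_on UNIV v" unfolding v_def[abs_def] by (intro continuous_intros cw cont)
  have "Lp_norm p (g b) \<le> 4 * (Lp_norm p (\<lambda>x. ?w x powr \<alpha> * u' b x) + \<bar>\<alpha>\<bar> * Lp_norm p (\<lambda>x. ?w x powr (\<alpha> - 1) * u x))"
    if b: "b \<in> Basis" for b
  proof -
    have le: "\<bar>g b x\<bar> \<le> \<bar>?w x powr \<alpha> * u' b x\<bar> + \<bar>\<alpha> * (?w x powr (\<alpha> - 1) * u x)\<bar>" for x
    proof -
      have "?w x powr (\<alpha> - 2) * \<bar>x \<bullet> b\<bar> \<le> ?w x powr (\<alpha> - 2) * ?w x"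
        by (intro mult_left_mono abs_inner_Basis_le_hyp_weight b) simp
      also have "\<dots> = ?w x powr (\<alpha> - 1)"
        using w[of x] powr_add[of "?w x" "\<alpha> - 2" 1] by simp
      finally have "(\<bar>\<alpha>\<bar> * \<bar>u x\<bar>) * (?w x powr (\<alpha> - 2) * \<bar>x \<bullet> b\<bar>) \<le> (\<bar>\<alpha>\<bar> * \<bar>u x\<bar>) * ?w x powr (\<alpha> - 1)"
        by (intro mult_left_mono) auto
      then have "\<bar>\<alpha> * ?w x powr (\<alpha> - 2) * (x \<bullet> b) * u x\<bar> \<le> \<bar>\<alpha> * (?w x powr (\<alpha> - 1) * u x)\<bar>"
        by (simp add: abs_mult mult.assoc mult.left_commute mult.commute)
      then show ?thesis unfolding g_def by (intro order_trans[OF abs_triangle_ineq]) auto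
    qed
    have "Lp_norm p (g b) \<le> 4 * (Lp_norm p (\<lambda>x. ?w x powr \<alpha> * u' b x) + Lp_norm p (\<lambda>x. \<alpha> * (?w x powr (\<alpha> - 1) * u x)))"
    proof (rule Lp_norm_le_add[OF p(1) cg[OF b] _ _ _ _ _ K(1) le])
      show "continuous_on UNIV (\<lambda>x. ?w x powr \<alpha> * u' b x)" by (intro continuous_intros cw cont b)
      show "continuous_on UNIV (\<lambda>x. \<alpha> * (?w x powr (\<alpha> - 1) * u x))" by (intro continuous_intros cw cont b)
    qed (use K(2) u'0[OF b] in \<open>auto simp: g_def\<close>)
    then show ?thesis using p by (simp add: Lp_norm_cmult)
  qed
  then have "\<gamma> * (\<Sum>b\<in>Basis. Lp_norm p (g b)) \<le> \<gamma> * (\<Sum>b\<in>Basis. 4 * (Lp_norm p (\<lambda>x. ?w x powr \<alpha> * u' b x)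
        + \<bar>\<alpha>\<bar> * Lp_norm p (\<lambda>x. ?w x powr (\<alpha> - 1) * u x)))"
    unfolding \<gamma>_def using p by (intro mult_left_mono sum_mono) auto
  moreover have "Lp_norm (sobolev_conj CARD('n) p) v \<le> \<gamma> * (\<Sum>b\<in>Basis. Lp_norm p (g b))"
    using Gagliardo_Nirenberg_Sobolev[of p v g K] d p v_deriv cv cg K
    by (simp add: sobolev_conj_def \<gamma>_def v_def)
  ultimately show ?thesis by (simp add: v_def[abs_def])
qed

text \<open>
  Both inequalities of the theorem are instances: \<open>G\<close> is a Sobolev norm of order \<open>1\<close> and \<open>k\<close> the constant
  of the embedding. At \<open>\<theta> = 0\<close> and \<open>\<theta> = 1\<close> the convention \<open>0 powr 0 = 0\<close> makes the right-hand side vanish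
  as soon as a norm with exponent \<open>0\<close> does. Therefore \<open>u = 0\<close> is treated first; for all other \<open>u\<close> the two
  Lebesgue norms of the interpolation are positive, and so is \<open>k G\<close>.
\<close>

lemma hyperboloid_interpolation:
  fixes u :: "real^'n \<Rightarrow> real"
  assumes p: "1 \<le> p" "p < real CARD('n)" and q: "1 \<le> q" "1 \<le> r"
    and \<theta>: "0 \<le> \<theta>" "\<theta> \<le> 1" and eq: "1 / r = \<theta> / q + (1 - \<theta>) / sobolev_conj CARD('n) p"
    and \<tau>: "\<tau> > 0" and u: "continuous_on UNIV u" and K: "compact K" "\<And>y. y \<notin> K \<Longrightarrow> u y = 0"
    and k: "\<tau> powr (1 / p) * Lp_norm (sobolev_conj CARD('n) p) (\<lambda>x. hyp_weight \<tau> x powr \<alpha> * u x) \<le> k * G"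
  shows "\<tau> powr ((1 - \<theta>) / real CARD('n)) * L_norm \<tau> r (1 + (\<theta> * \<beta> + (1 - \<theta>) * \<alpha>) * r) u
      \<le> k powr (1 - \<theta>) * L_norm \<tau> q (1 + \<beta> * q) u powr \<theta> * G powr (1 - \<theta>)"
proof (cases "\<exists>z. u z \<noteq> 0")
  case False
  then have "L_norm \<tau> r c u = 0" for c using q by (simp add: L_norm_def)
  then show ?thesis by simp
next
  case True
  then obtain z where z: "u z \<noteq> 0" by blast
  let ?w = "hyp_weight \<tau> :: real^'n \<Rightarrow> real" and ?d = "real CARD('n)"
  define s where "s = sobolev_conj CARD('n) p"
  have w: "?w x > 0" for x by (rule hyp_weight_pos[OF \<tau>])
  have s: "s > 0" "1 / s = 1 / p - 1 / ?d"
    using p by (simp_all add: s_def sobolev_conj_def field_simps)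
  define f where "f x = ?w x powr \<beta> * u x" for x
  define g where "g x = ?w x powr \<alpha> * u x" for x
  define h where "h x = ?w x powr (\<theta> * \<beta> + (1 - \<theta>) * \<alpha>) * u x" for x
  have cw: "continuous_on UNIV (\<lambda>x. ?w x powr c)" for c by (rule continuous_on_hyp_weight_powr[OF \<tau>])
  have c: "continuous_on UNIV f" "continuous_on UNIV g"
    unfolding f_def[abs_def] g_def[abs_def] by (intro continuous_intros cw u)+
  have fK: "\<And>x. x \<notin> K \<Longrightarrow> f x = 0" and gK: "\<And>x. x \<notin> K \<Longrightarrow> g x = 0"
    using K(2) by (auto simp: f_def g_def)
  have "f z \<noteq> 0" "g z \<noteq> 0" using z w[of z] by (simp_all add: f_def g_def)
  then have pos: "Lp_norm q f > 0" "Lp_norm s g > 0"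
    using q s by (auto intro!: Lp_norm_pos[OF c(1) K(1) fK] Lp_norm_pos[OF c(2) K(1) gK])
  have le: "Lp_norm r h \<le> Lp_norm q f powr \<theta> * Lp_norm s g powr (1 - \<theta>)"
  proof -
    consider "\<theta> = 0" | "\<theta> = 1" | "0 < \<theta>" "\<theta> < 1" using \<theta> by linarith
    then show ?thesis
    proof cases
      case 1
      then have "r = s" "h = g" using eq q s by (auto simp: s_def g_def h_def field_simps)
      then show ?thesis using 1 pos by simp
    next
      case 2
      then have "r = q" "h = f" using eq q s by (auto simp: f_def h_def field_simps)
      then show ?thesis using 2 pos by simp
    next
      case 3
      have "\<bar>h x\<bar> = \<bar>\<bar>f x\<bar> powr \<theta> * \<bar>g x\<bar> powr (1 - \<theta>)\<bar>" for x
      proof (cases "u x = 0")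
        case False
        then have uu: "\<bar>u x\<bar> powr \<theta> * \<bar>u x\<bar> powr (1 - \<theta>) = \<bar>u x\<bar>"
          using powr_add[of "\<bar>u x\<bar>" \<theta> "1 - \<theta>"] by simp
        have "\<bar>f x\<bar> powr \<theta> * \<bar>g x\<bar> powr (1 - \<theta>) = ?w x powr (\<beta> * \<theta> + \<alpha> * (1 - \<theta>)) * \<bar>u x\<bar>"
          by (simp add: f_def g_def abs_mult powr_mult powr_powr powr_add uu)
        then show ?thesis using False by (simp add: h_def abs_mult mult.commute)
      qed (simp add: f_def g_def h_def)
      then have "Lp_norm r h = Lp_norm r (\<lambda>x. \<bar>f x\<bar> powr \<theta> * \<bar>g x\<bar> powr (1 - \<theta>))"
        unfolding Lp_norm_def by presburger
      also have "\<dots> \<le> Lp_norm q f powr \<theta> * Lp_norm s g powr (1 - \<theta>)"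
        using q s eq by (intro Lp_norm_interpolation[OF c(1) fK c(2) gK K(1) 3]) (auto simp: s_def)
      finally show ?thesis .
    qed
  qed
  have G: "Lp_norm s g \<le> \<tau> powr (- 1 / p) * (k * G)"
    using mult_left_mono[OF k, of "\<tau> powr (- 1 / p)"] \<tau>
    by (simp add: s_def g_def[abs_def] flip: mult.assoc powr_add)
  have "\<tau> powr ((1 - \<theta>) / ?d) * L_norm \<tau> r (1 + (\<theta> * \<beta> + (1 - \<theta>) * \<alpha>) * r) u
      = \<tau> powr ((1 - \<theta>) / ?d + 1 / r) * Lp_norm r h"
    using q by (simp add: L_norm_eq_Lp_norm[OF \<tau> _ u] powr_add h_def[abs_def])
  also have "\<dots> \<le> \<tau> powr ((1 - \<theta>) / ?d + 1 / r) * (Lp_norm q f powr \<theta> * (\<tau> powr (- 1 / p) * (k * G)) powr (1 - \<theta>))"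
    using \<theta> G pos by (intro mult_left_mono order_trans[OF le] powr_mono2) auto
  also have "\<dots> = \<tau> powr ((1 - \<theta>) / ?d + 1 / r + (- 1 / p) * (1 - \<theta>)) * (Lp_norm q f powr \<theta> * (k powr (1 - \<theta>) * G powr (1 - \<theta>)))"
    by (simp only: powr_mult powr_powr powr_add mult_ac)
  also have "(1 - \<theta>) / ?d + 1 / r + (- 1 / p) * (1 - \<theta>) = 1 / q * \<theta>"
  proof -
    have "1 / r = \<theta> / q + (1 - \<theta>) * (1 / p - 1 / ?d)" unfolding eq s(2)[symmetric] by (simp add: s_def)
    then show ?thesis by (simp add: algebra_simps)
  qed
  also have "\<tau> powr (1 / q * \<theta>) * (Lp_norm q f powr \<theta> * (k powr (1 - \<theta>) * G powr (1 - \<theta>)))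
      = k powr (1 - \<theta>) * L_norm \<tau> q (1 + \<beta> * q) u powr \<theta> * G powr (1 - \<theta>)"
    using q by (simp add: L_norm_eq_Lp_norm[OF \<tau> _ u] powr_mult powr_powr f_def[abs_def])
  finally show ?thesis .
qed

theorem proposition2p3:
  fixes p q r \<theta> \<alpha> \<beta> :: real
  assumes "CARD('n::finite) \<ge> 2"
    and "1 \<le> p" and "p < real CARD('n)"
    and "1 \<le> q" and "q \<le> r" and "r \<le> sobolev_conj CARD('n) p"
    and "0 \<le> \<theta>" and "\<theta> \<le> 1"
    and "1 / r = \<theta> / q + (1 - \<theta>) / sobolev_conj CARD('n) p"
  shows "\<exists>C::real. \<forall>\<tau>>0. \<forall>u :: real^'n \<Rightarrow> real. smooth u \<longrightarrow> compactly_supported u \<longrightarrow>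
    \<tau> powr ((1 - \<theta>) / real CARD('n)) * L_norm \<tau> r (1 + \<theta> * \<beta> * r) u
      \<le> C * L_norm \<tau> q (1 + \<beta> * q) u powr \<theta>
          * W_hom_norm \<tau> 1 p (1 - p) u powr (1 - \<theta>)
    \<and> \<tau> powr ((1 - \<theta>) / real CARD('n)) * L_norm \<tau> r (1 + (\<theta> * \<beta> + (1 - \<theta>) * \<alpha>) * r) u
      \<le> C * L_norm \<tau> q (1 + \<beta> * q) u powr \<theta>
          * W_norm \<tau> 1 p (1 - p + \<alpha> * p) u powr (1 - \<theta>)"
proof -
  let ?d = "real CARD('n)"
  define \<gamma> where "\<gamma> = p * (?d - 1) / (?d - p)"
  \<comment> \<open>Both terms of the weighted Sobolev inequality for \<open>\<alpha>\<close>, and the only nonzero term of the one for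
    exponent \<open>0\<close>, have a coefficient that is at most \<open>k\<close>.\<close>
  define k where "k = 4 * \<gamma> * (1 + ?d * \<bar>\<alpha>\<bar>)"
  have \<gamma>: "\<gamma> \<ge> 0" using assms by (simp add: \<gamma>_def)
  have k: "4 * \<gamma> \<le> k" "4 * \<gamma> * (?d * \<bar>\<alpha>\<bar>) \<le> k"
    using \<gamma> by (auto simp: k_def algebra_simps)
  have main: "\<tau> powr (1 / p) * Lp_norm (sobolev_conj CARD('n) p) (\<lambda>x. hyp_weight \<tau> x powr a * u x)
      \<le> 4 * \<gamma> * W_hom_norm \<tau> 1 p (1 - p + a * p) u + 4 * \<gamma> * (?d * \<bar>a\<bar>) * L_norm \<tau> p (1 - p + a * p) u
      \<and> continuous_on UNIV u"
    if \<tau>: "\<tau> > 0" and u: "smooth u" "compactly_supported u" for \<tau> a and u :: "real^'n \<Rightarrow> real"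
  proof -
    let ?w = "hyp_weight \<tau> :: real^'n \<Rightarrow> real"
    have w: "?w x > 0" for x by (rule hyp_weight_pos[OF \<tau>])
    define u' where "u' b x = deriv (\<lambda>s. u (x + s *\<^sub>R b)) 0" for b x
    have partial: "partial i u = u' (axis i 1)" for i by (auto simp: partial_def u'_def)
    have C1: "u differentiable_on UNIV" "\<And>i. continuous_on UNIV (partial i u)"
      using u(1)[unfolded smooth_def, rule_format, of 1] by auto
    have Basis: "(Basis :: (real^'n) set) = range (\<lambda>i. axis i 1)" by (auto simp: Basis_vec_def)
    have inj: "inj (\<lambda>i::'n. axis i (1::real))" by (auto simp: inj_on_def axis_eq_axis)
    have deriv: "((\<lambda>h. u (y + h *\<^sub>R b)) has_real_derivative u' b y) (at 0)" for b y
    proof -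
      have "u differentiable (at (y + 0 *\<^sub>R b))" using C1(1) by (simp add: differentiable_on_def)
      moreover have "(\<lambda>h. y + h *\<^sub>R b) differentiable (at (0::real))" by simp
      ultimately have "(u \<circ> (\<lambda>h. y + h *\<^sub>R b)) differentiable (at 0)" by (intro differentiable_chain_at) auto
      then show ?thesis unfolding u'_def by (simp add: DERIV_deriv_iff_real_differentiable o_def)
    qed
    have cu: "continuous_on UNIV u" using C1(1) by (rule differentiable_imp_continuous_on)
    have cu': "continuous_on UNIV (u' b)" if "b \<in> Basis" for b using that C1(2) by (auto simp: Basis partial)
    have cw: "continuous_on UNIV (\<lambda>x. ?w x powr c)" for c by (rule continuous_on_hyp_weight_powr[OF \<tau>])
    define K where "K = closure {x. u x \<noteq> 0}"
    have K: "compact K" "\<And>y. y \<notin> K \<Longrightarrow> u y = 0"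
      using u(2) closure_subset[of "{x. u x \<noteq> 0}"] by (auto simp: K_def compactly_supported_def)
    have e: "1 - p + a * p = 1 + (a - 1) * p" by (simp add: algebra_simps)
    have L: "L_norm \<tau> p (1 - p + a * p) u = \<tau> powr (1 / p) * Lp_norm p (\<lambda>x. ?w x powr (a - 1) * u x)"
      unfolding e using assms by (intro L_norm_eq_Lp_norm \<tau> cu) auto
    have LB: "L_norm \<tau> p (1 - p + a * p) (boost \<tau> i u) = \<tau> powr (1 / p) * Lp_norm p (\<lambda>x. ?w x powr a * u' (axis i 1) x)" for i
    proof -
      have cb: "continuous_on UNIV (boost \<tau> i u)"
        using cw[of 1] w C1(2)[of i] by (auto simp: boost_def[abs_def] less_imp_le intro!: continuous_intros)
      have wb: "?w x powr (a - 1) * boost \<tau> i u x = ?w x powr a * u' (axis i 1) x" for x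
        using w[of x] powr_add[of "?w x" "a - 1" 1] by (simp add: boost_def partial)
      show ?thesis
        unfolding e using assms by (subst L_norm_eq_Lp_norm[OF \<tau> _ cb]) (auto simp: wb)
    qed
    have "(\<Sum>b\<in>Basis. 4 * (Lp_norm p (\<lambda>x. ?w x powr a * u' b x) + \<bar>a\<bar> * Lp_norm p (\<lambda>x. ?w x powr (a - 1) * u x)))
       = (\<Sum>i\<in>UNIV. 4 * (Lp_norm p (\<lambda>x. ?w x powr a * u' (axis i 1) x) + \<bar>a\<bar> * Lp_norm p (\<lambda>x. ?w x powr (a - 1) * u x)))"
      unfolding Basis by (subst sum.reindex[OF inj]) simp
    then have "Lp_norm (sobolev_conj CARD('n) p) (\<lambda>x. ?w x powr a * u x)
       \<le> \<gamma> * (\<Sum>i\<in>UNIV. 4 * (Lp_norm p (\<lambda>x. ?w x powr a * u' (axis i 1) x) + \<bar>a\<bar> * Lp_norm p (\<lambda>x. ?w x powr (a - 1) * u x)))"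
      using weighted_Sobolev[OF assms(1-3) \<tau> deriv cu cu' K, of a] by (simp add: \<gamma>_def)
    also have "\<dots> = 4 * \<gamma> * (\<Sum>i\<in>UNIV. Lp_norm p (\<lambda>x. ?w x powr a * u' (axis i 1) x)) +
        4 * \<gamma> * (?d * \<bar>a\<bar>) * Lp_norm p (\<lambda>x. ?w x powr (a - 1) * u x)"
      by (simp add: sum.distrib sum_distrib_left[symmetric] algebra_simps)
    finally have "\<tau> powr (1 / p) * Lp_norm (sobolev_conj CARD('n) p) (\<lambda>x. ?w x powr a * u x) \<le> \<tau> powr (1 / p) * \<dots>"
      by (rule mult_left_mono) simp
    moreover have "W_hom_norm \<tau> 1 p (1 - p + a * p) u
        = \<tau> powr (1 / p) * (\<Sum>i\<in>UNIV. Lp_norm p (\<lambda>x. ?w x powr a * u' (axis i 1) x))"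
      unfolding W_hom_norm_1 LB sum_distrib_left ..
    ultimately show ?thesis using cu unfolding L by (simp only: distrib_left mult_ac simp_thms)
  qed
  have nn: "W_hom_norm \<tau> j p a u \<ge> 0" "L_norm \<tau> p a u \<ge> 0" for \<tau> j a and u :: "real^'n \<Rightarrow> real"
    by (auto simp: W_hom_norm_def L_norm_def intro!: sum_nonneg)
  show ?thesis
  proof (intro exI[of _ "k powr (1 - \<theta>)"] allI impI conjI)
    fix \<tau> :: real and u :: "real^'n \<Rightarrow> real"
    assume \<tau>: "\<tau> > 0" and u: "smooth u" "compactly_supported u"
    obtain K where K: "compact K" "\<And>y. y \<notin> K \<Longrightarrow> u y = 0"
    proof (rule that)
      show "compact (closure {x. u x \<noteq> 0})" using u(2) by (simp add: compactly_supported_def)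
      show "u y = 0" if "y \<notin> closure {x. u x \<noteq> 0}" for y
        using that closure_subset[of "{x. u x \<noteq> 0}"] by auto
    qed
    have cu: "continuous_on UNIV u" using main[OF \<tau> u] by blast
    have r: "1 \<le> r" using assms by simp
    note interp = hyperboloid_interpolation[OF assms(2-4) r assms(7-9) \<tau> cu K]
    have "4 * \<gamma> * W_hom_norm \<tau> 1 p (1 - p) u \<le> k * W_hom_norm \<tau> 1 p (1 - p) u"
      by (intro mult_right_mono k nn)
    then have "\<tau> powr (1 / p) * Lp_norm (sobolev_conj CARD('n) p) (\<lambda>x. hyp_weight \<tau> x powr 0 * u x)
        \<le> k * W_hom_norm \<tau> 1 p (1 - p) u"
      using main[OF \<tau> u, of 0] by simp
    from interp[OF _ this, of \<beta>]
    show "\<tau> powr ((1 - \<theta>) / ?d) * L_norm \<tau> r (1 + \<theta> * \<beta> * r) u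
      \<le> k powr (1 - \<theta>) * L_norm \<tau> q (1 + \<beta> * q) u powr \<theta> * W_hom_norm \<tau> 1 p (1 - p) u powr (1 - \<theta>)"
      by simp
    let ?H = "W_hom_norm \<tau> 1 p (1 - p + \<alpha> * p) u" and ?L = "L_norm \<tau> p (1 - p + \<alpha> * p) u"
    have W: "W_norm \<tau> 1 p (1 - p + \<alpha> * p) u = ?L + ?H"
      by (simp add: W_norm_def W_hom_norm_0)
    have "4 * \<gamma> * ?H + 4 * \<gamma> * (?d * \<bar>\<alpha>\<bar>) * ?L \<le> k * ?H + k * ?L"
      by (intro add_mono mult_right_mono k nn)
    then have "\<tau> powr (1 / p) * Lp_norm (sobolev_conj CARD('n) p) (\<lambda>x. hyp_weight \<tau> x powr \<alpha> * u x)
        \<le> k * W_norm \<tau> 1 p (1 - p + \<alpha> * p) u"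
      using main[OF \<tau> u, of \<alpha>] unfolding W distrib_left by linarith
    from interp[OF _ this, of \<beta>]
    show "\<tau> powr ((1 - \<theta>) / ?d) * L_norm \<tau> r (1 + (\<theta> * \<beta> + (1 - \<theta>) * \<alpha>) * r) u
      \<le> k powr (1 - \<theta>) * L_norm \<tau> q (1 + \<beta> * q) u powr \<theta> * W_norm \<tau> 1 p (1 - p + \<alpha> * p) u powr (1 - \<theta>)"
      by simp
  qed
qed

end
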